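(* Let $\{P_\theta:\theta\in\Theta\}$, $\Theta\subset\mathbb{R}^d$ open, satisfy the regularity condition of order $2$ at $\theta\in\Theta$ (see context), and let $T$ be an unbiased estimator of $\theta$ with finite second moments, covariance matrix $\Sigma=\Sigma(\theta)$, and let $J=J(\theta)$ be the Fisher information matrix. For a symmetric matrix $\Delta\in\mathbb{R}^{d\times d}$ define the degree-6 form $$P_\Delta(v)=\big(\delta(v)^\top\xi(v)\big)^2-\big(v^\top\Delta v\big)\big(\xi(v)^\top G_{\mathcal N}\,\xi(v)\big),\qquad v\in\mathbb{R}^d,$$ with $\delta,\xi,G_{\mathcal N}$ as in the context. Let $z(v)$ be the vector of all $M=\binom{d+2}{3}$ monomials in $v_1,\dots,v_d$ of degree exactly $3$. Suppose $\Delta\in\mathbb{R}^{d\times d}$ and $S\in\mathbb{R}^{M\times M}$ are symmetric with $\Delta\succeq0$, $S\succeq 0$ and $$P_\Delta(v)\equiv z(v)^\top S\,z(v)\quad\text{as polynomials in }v.$$ Then for every $v\in\mathbb{R}^d$, $$v^\top\Delta v\le v^\top(\Sigma-J^{-1})v,$$ and consequently $\Sigma\succeq J^{-1}+\Delta$.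
   Context: Setting. $(\mathcal X,\mathcal F)$ is a measurable space with a $\sigma$-finite measure $\mu$; $\{P_\theta:\theta\in\Theta\}$, $\Theta\subset\mathbb{R}^d$ open, is a family of probability measures with strictly positive densities $f(x;\theta)=dP_\theta/d\mu$. $H=L^2(\mu)$ (real) with inner product $\langle u,w\rangle=\int uw\,d\mu$ and norm $\|\cdot\|$; $\mathrm{Proj}_V$ is orthogonal projection onto a closed subspace $V\subseteq H$. The square-root embedding is $s:\Theta\to H$, $s(\theta)(x)=\sqrt{f(x;\theta)}$. For a multi-index $\alpha\in\mathbb{N}_0^d$, $|\alpha|=\sum_i\alpha_i$, $\partial^\alpha=\partial_1^{\alpha_1}\cdots\partial_d^{\alpha_d}$ (derivatives in $\theta$), and $\eta_\alpha(\theta)=\partial^\alpha s(\theta)$; in particular $\eta_i=\partial_i s$. Regularity of order $m$ (at $\theta$): (i) $s:\Theta\to H$ is $m$-times Fréchet differentiable, so $\eta_\alpha(\theta)\in H$ for $1\le|\alpha|\le m$ and every $\theta\in\Theta$; (ii) the partial derivatives $\partial^\alpha f(x;\theta)$ exist for $|\alpha|\le m$, and for every real-valued statistic $T$ with $\mathbb{E}_\theta[T^2]<\infty$ (for all $\theta$) one has $\partial^\alpha\int T(x)f(x;\theta)\,d\mu=\int T(x)\,\partial^\alpha f(x;\theta)\,d\mu$ for all $|\alpha|\le m$; (iii) the Gram matrix $G^{(m)}(\theta)$ with entries $\langle\eta_\alpha,\eta_\beta\rangle$, $1\le|\alpha|,|\beta|\le m$, is strictly positive definite at $\theta$. Everything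 below is evaluated at the fixed $\theta$. $G=(\langle\eta_i,\eta_j\rangle)_{i,j=1}^d$; the Fisher information matrix is $J=4G$, i.e. $J_{ij}=4\langle\eta_i,\eta_j\rangle=\mathbb{E}_\theta[\partial_i\log f\,\partial_j\log f]$. $\mathcal T_1=\mathrm{span}\{\eta_1,\dots,\eta_d\}\subset H$. The second fundamental form has components $\Pi_{ij}=\partial_i\eta_j-\mathrm{Proj}_{\mathcal T_1}(\partial_i\eta_j)\in\mathcal T_1^\perp$ (symmetric in $i,j$). Estimator. $T=(T_1,\dots,T_d):\mathcal X\to\mathbb{R}^d$ is measurable with $\mathbb{E}_\theta[T_p^2]<\infty$ and $\mathbb{E}_\theta[T]=\theta$ for all $\theta\in\Theta$; $\Sigma(\theta)_{pq}=\mathbb{E}_\theta[(T_p-\theta_p)(T_q-\theta_q)]$. The lifted errors are $\widetilde Z^{(p)}=(T_p-\theta_p)\,s(\theta)\in H$. For $v\in\mathbb{R}^d$: $Z_v=\sum_{p}v_p\widetilde Z^{(p)}$, $\widetilde v=G^{-1}v$, $\Pi_v=\sum_{i,j=1}^d\widetilde v_i\widetilde v_j\Pi_{ij}$. Indexing. $\mathcal I=\{(i,j):1\le i\le j\le d\}$, $|\mathcal I|=d(d+1)/2$; for $\alpha=(i,j)\in\mathcal I$ put $\Pi_\alpha=\Pi_{ij}$. $G_{\mathcal N}$ is the $|\mathcal I|\times|\mathcal I|$ matrix $(G_{\mathcal N})_{\alpha\beta}=\langle\Pi_\alpha,\Pi_\beta\rangle$; $C\in\mathbb{R}^{d\times|\mathcal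 I|}$ has entries $C_{p,\alpha}=\langle\widetilde Z^{(p)},\Pi_\alpha\rangle$; $\delta(v)=C^\top v\in\mathbb{R}^{|\mathcal I|}$; and $\xi(v)\in\mathbb{R}^{|\mathcal I|}$ has entries $\xi_{(i,i)}(v)=\widetilde v_i^2$ and $\xi_{(i,j)}(v)=2\widetilde v_i\widetilde v_j$ for $i<j$. Thus $\delta(v)^\top\xi(v)=\langle Z_v,\Pi_v\rangle$ and $\xi(v)^\top G_{\mathcal N}\xi(v)=\|\Pi_v\|^2$. $A\succeq B$ for symmetric matrices means $A-B$ is positive semidefinite. *)

theory Defs
  imports "HOL-Probability.Probability"
begin

type_synonym 'd rvec = "(real, 'd) vec"
type_synonym 'd rmat = "((real, 'd) vec, 'd) vec"

section \<open>The space \<open>L\<^sup>2(M)\<close>\<close>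

text \<open>
  Elements of \<open>L\<^sup>2(M)\<close> are handled through representatives: square-integrable measurable
  functions, two of which denote the same element iff the seminorm of their difference vanishes,
  i.e. iff they agree almost everywhere.
\<close>

definition L2 :: "'a measure \<Rightarrow> ('a \<Rightarrow> real) set" where
  "L2 M = {u \<in> borel_measurable M. integrable M (\<lambda>x. (u x)\<^sup>2)}"

definition L2_inner :: "'a measure \<Rightarrow> ('a \<Rightarrow> real) \<Rightarrow> ('a \<Rightarrow> real) \<Rightarrow> real" where
  "L2_inner M u w = (\<integral>x. u x * w x \<partial>M)"

definition L2_nrm :: "'a measure \<Rightarrow> ('a \<Rightarrow> real) \<Rightarrow> real" where
  "L2_nrm M u = sqrt (L2_inner M u u)"

text \<open>
  Convergence in \<open>L\<^sup>2(M)\<close>. Membership in \<^term>\<open>L2 M\<close> is required explicitly, because the Bochner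
  integral (and hence \<^const>\<open>L2_nrm\<close>) is \<open>0\<close> on functions that are not square integrable.
\<close>

definition L2_tendsto ::
    "'a measure \<Rightarrow> ('b \<Rightarrow> 'a \<Rightarrow> real) \<Rightarrow> ('a \<Rightarrow> real) \<Rightarrow> 'b filter \<Rightarrow> bool" where
  "L2_tendsto M u w F \<longleftrightarrow>
     w \<in> L2 M \<and> (\<forall>\<^sub>F t in F. u t \<in> L2 M) \<and>
     ((\<lambda>t. L2_nrm M (\<lambda>x. u t x - w x)) \<longlongrightarrow> 0) F"

text \<open>
  Orthogonal projection onto the (closed) subspace \<^term>\<open>V\<close>, unique up to almost-everywhere equality.
\<close>

definition L2_proj :: "'a measure \<Rightarrow> ('a \<Rightarrow> real) set \<Rightarrow> ('a \<Rightarrow> real) \<Rightarrow> ('a \<Rightarrow> real)" where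
  "L2_proj M V u = (SOME w. w \<in> V \<and> (\<forall>y\<in>V. L2_inner M (\<lambda>x. u x - w x) y = 0))"


section \<open>Derivatives of maps into \<open>L\<^sup>2(M)\<close>\<close>

text \<open>Bounded \<open>k\<close>-linear maps into \<open>L\<^sup>2(M)\<close>; the \<open>k\<close> arguments are given as a list.\<close>

definition L2_bounded_multilinear ::
    "'a measure \<Rightarrow> nat \<Rightarrow> ('v::real_normed_vector list \<Rightarrow> 'a \<Rightarrow> real) \<Rightarrow> bool" where
  "L2_bounded_multilinear M k A \<longleftrightarrow>
     (\<forall>vs. length vs = k \<longrightarrow> A vs \<in> L2 M) \<and>
     (\<forall>vs i v w a b. length vs = k \<longrightarrow> i < k \<longrightarrow>
        (AE x in M. A (vs[i := a *\<^sub>R v + b *\<^sub>R w]) x = a * A (vs[i := v]) x + b * A (vs[i := w]) x)) \<and>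
     (\<exists>K. \<forall>vs. length vs = k \<longrightarrow> L2_nrm M (A vs) \<le> K * prod_list (map norm vs))"

text \<open>
  \<open>D \<theta> [v\<^sub>1, \<dots>, v\<^sub>k]\<close> is the \<open>k\<close>-th derivative of \<open>u\<close> at \<open>\<theta>\<close> applied to
  \<open>v\<^sub>1, \<dots>, v\<^sub>k\<close>. The last clause says that \<open>D \<theta> (h # vs)\<close> is the Frechet derivative, in
  direction \<open>h\<close>, of the \<open>k\<close>-th derivative, with respect to the operator norm on
  \<open>k\<close>-linear maps (uniformity over \<open>vs\<close> in the unit ball).
\<close>

definition L2_frechet_differentiable ::
    "'a measure \<Rightarrow> nat \<Rightarrow> 'v::real_normed_vector set \<Rightarrow> ('v \<Rightarrow> 'a \<Rightarrow> real) \<Rightarrow> bool" where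
  "L2_frechet_differentiable M m \<Theta> u \<longleftrightarrow>
     (\<exists>D :: 'v \<Rightarrow> 'v list \<Rightarrow> 'a \<Rightarrow> real.
        (\<forall>\<theta>\<in>\<Theta>. D \<theta> [] = u \<theta>) \<and>
        (\<forall>k\<le>m. \<forall>\<theta>\<in>\<Theta>. L2_bounded_multilinear M k (D \<theta>)) \<and>
        (\<forall>k<m. \<forall>\<theta>\<in>\<Theta>. \<forall>\<epsilon>>0. \<forall>\<^sub>F h in at 0. \<forall>vs. length vs = k \<and> (\<forall>v\<in>set vs. norm v \<le> 1) \<longrightarrow>
           L2_nrm M (\<lambda>x. D (\<theta> + h) vs x - D \<theta> vs x - D \<theta> (h # vs) x) \<le> \<epsilon> * norm h))"

definition L2_partial ::
    "'a measure \<Rightarrow> 'd::finite \<Rightarrow> (real^'d \<Rightarrow> 'a \<Rightarrow> real) \<Rightarrow> real^'d \<Rightarrow> 'a \<Rightarrow> real" where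
  "L2_partial M i u \<theta> =
     (SOME w. L2_tendsto M (\<lambda>t x. (u (\<theta> + t *\<^sub>R axis i 1) x - u \<theta> x) / t) w (at 0))"


section \<open>Multi-indices and partial derivatives of real functions\<close>

text \<open>
  A multi-index is a function \<^typ>\<open>'d \<Rightarrow> nat\<close>. Its \<open>index_list\<close> is the increasing list of
  indices in which \<open>i\<close> occurs \<open>\<alpha> i\<close> times, so that \<open>foldr\<close> over it yields
  \<open>\<partial>\<^sub>1\<^bsup>\<alpha>\<^sub>1\<^esup> \<dots> \<partial>\<^sub>d\<^bsup>\<alpha>\<^sub>d\<^esup>\<close>, the derivatives with respect to the last variables being taken first.
\<close>

definition mi_degree :: "('d::finite \<Rightarrow> nat) \<Rightarrow> nat" where
  "mi_degree \<alpha> = (\<Sum>i\<in>UNIV. \<alpha> i)"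

definition index_list :: "('d::{finite,linorder} \<Rightarrow> nat) \<Rightarrow> 'd list" where
  "index_list \<alpha> = concat (map (\<lambda>i. replicate (\<alpha> i) i) (sorted_list_of_set UNIV))"

definition partial :: "'d::finite \<Rightarrow> (real^'d \<Rightarrow> real) \<Rightarrow> real^'d \<Rightarrow> real" where
  "partial i g \<theta> = deriv (\<lambda>t. g (\<theta> + t *\<^sub>R axis i 1)) 0"

primrec partials_exist :: "(real^'d) set \<Rightarrow> 'd::finite list \<Rightarrow> (real^'d \<Rightarrow> real) \<Rightarrow> bool" where
  "partials_exist \<Theta> [] g \<longleftrightarrow> True"
| "partials_exist \<Theta> (i # is) g \<longleftrightarrow> partials_exist \<Theta> is g \<and>
     (\<forall>\<theta>\<in>\<Theta>. (\<lambda>t::real. foldr partial is g (\<theta> + t *\<^sub>R axis i 1)) differentiable (at 0))"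

lemma finite_mi_degree_le: "finite {\<alpha> :: 'd::finite \<Rightarrow> nat. mi_degree \<alpha> \<le> m}"
proof (rule finite_subset)
  show "{\<alpha> :: 'd \<Rightarrow> nat. mi_degree \<alpha> \<le> m} \<subseteq> (UNIV \<rightarrow>\<^sub>E {..m})"
  proof
    fix \<alpha> :: "'d \<Rightarrow> nat" assume "\<alpha> \<in> {\<alpha>. mi_degree \<alpha> \<le> m}"
    then have le: "sum \<alpha> UNIV \<le> m" by (simp add: mi_degree_def)
    have "\<alpha> i \<le> m" for i
      using member_le_sum[of i UNIV \<alpha>] le by simp
    then show "\<alpha> \<in> UNIV \<rightarrow>\<^sub>E {..m}" by (simp add: PiE_iff)
  qed
  show "finite ((UNIV :: 'd set) \<rightarrow>\<^sub>E {..m})"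
    by (intro finite_PiE) auto
qed


section \<open>Statistical families and the regularity condition\<close>

definition density_family ::
    "'a measure \<Rightarrow> (real^'d::finite) set \<Rightarrow> (real^'d \<Rightarrow> 'a measure) \<Rightarrow> (real^'d \<Rightarrow> 'a \<Rightarrow> real) \<Rightarrow> bool"
  where
  "density_family M \<Theta> P f \<longleftrightarrow>
     (\<forall>\<theta>\<in>\<Theta>. prob_space (P \<theta>) \<and> f \<theta> \<in> borel_measurable M \<and> (\<forall>x\<in>space M. 0 < f \<theta> x) \<and>
            P \<theta> = density M (\<lambda>x. ennreal (f \<theta> x)))"

definition sqrt_emb :: "(real^'d \<Rightarrow> 'a \<Rightarrow> real) \<Rightarrow> real^'d \<Rightarrow> 'a \<Rightarrow> real" where
  "sqrt_emb f \<theta> x = sqrt (f \<theta> x)"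

definition eta ::
    "'a measure \<Rightarrow> ('d::{finite,linorder} rvec \<Rightarrow> 'a \<Rightarrow> real) \<Rightarrow> ('d \<Rightarrow> nat) \<Rightarrow> 'd rvec \<Rightarrow> 'a \<Rightarrow> real" where
  "eta M f \<alpha> = foldr (L2_partial M) (index_list \<alpha>) (sqrt_emb f)"

text \<open>
  Clause (i) and clause (ii) concern the whole family, clause (iii) the single point \<open>\<theta>0\<close>.
  The interchange identity in (ii) includes the existence of both of its sides.
\<close>

definition regular ::
    "'a measure \<Rightarrow> ('d::{finite,linorder} rvec) set \<Rightarrow> ('d rvec \<Rightarrow> 'a measure) \<Rightarrow>
     ('d rvec \<Rightarrow> 'a \<Rightarrow> real) \<Rightarrow> nat \<Rightarrow> 'd rvec \<Rightarrow> bool" where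
  "regular M \<Theta> P f m \<theta>0 \<longleftrightarrow>
     \<comment> \<open>(i)\<close>
     L2_frechet_differentiable M m \<Theta> (sqrt_emb f) \<and>
     \<comment> \<open>(ii)\<close>
     (\<forall>\<alpha>. mi_degree \<alpha> \<le> m \<longrightarrow>
        (\<forall>x\<in>space M. partials_exist \<Theta> (index_list \<alpha>) (\<lambda>\<theta>. f \<theta> x))) \<and>
     (\<forall>T\<in>borel_measurable M. (\<forall>\<theta>\<in>\<Theta>. integrable (P \<theta>) (\<lambda>x. (T x)\<^sup>2)) \<longrightarrow>
        (\<forall>\<alpha>. mi_degree \<alpha> \<le> m \<longrightarrow>
           partials_exist \<Theta> (index_list \<alpha>) (\<lambda>\<theta>. \<integral>x. T x * f \<theta> x \<partial>M) \<and>
           (\<forall>\<theta>\<in>\<Theta>.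
              integrable M (\<lambda>x. T x * foldr partial (index_list \<alpha>) (\<lambda>\<theta>. f \<theta> x) \<theta>) \<and>
              foldr partial (index_list \<alpha>) (\<lambda>\<theta>. \<integral>x. T x * f \<theta> x \<partial>M) \<theta> =
                (\<integral>x. T x * foldr partial (index_list \<alpha>) (\<lambda>\<theta>. f \<theta> x) \<theta> \<partial>M)))) \<and>
     \<comment> \<open>(iii)\<close>
     (let A = {\<alpha>. 1 \<le> mi_degree \<alpha> \<and> mi_degree \<alpha> \<le> m} in
        \<forall>c :: ('d \<Rightarrow> nat) \<Rightarrow> real. (\<exists>\<alpha>\<in>A. c \<alpha> \<noteq> 0) \<longrightarrow>
          0 < (\<Sum>\<alpha>\<in>A. \<Sum>\<beta>\<in>A. c \<alpha> * L2_inner M (eta M f \<alpha> \<theta>0) (eta M f \<beta> \<theta>0) * c \<beta>))"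

definition unbiased_estimator ::
    "'a measure \<Rightarrow> (real^'d::finite) set \<Rightarrow> (real^'d \<Rightarrow> 'a measure) \<Rightarrow> ('a \<Rightarrow> real^'d) \<Rightarrow> bool" where
  "unbiased_estimator M \<Theta> P T \<longleftrightarrow>
     T \<in> borel_measurable M \<and>
     (\<forall>\<theta>\<in>\<Theta>. (\<forall>p. integrable (P \<theta>) (\<lambda>x. (T x $ p)\<^sup>2)) \<and> (\<integral>x. T x \<partial>P \<theta>) = \<theta>)"

definition cov_mat :: "(real^'d \<Rightarrow> 'a measure) \<Rightarrow> ('a \<Rightarrow> real^'d::finite) \<Rightarrow> real^'d \<Rightarrow> real^'d^'d" where
  "cov_mat P T \<theta> = (\<chi> p q. \<integral>x. (T x $ p - \<theta> $ p) * (T x $ q - \<theta> $ q) \<partial>P \<theta>)"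


section \<open>Fisher information and second fundamental form\<close>

definition eta1 :: "'a measure \<Rightarrow> (real^'d::finite \<Rightarrow> 'a \<Rightarrow> real) \<Rightarrow> 'd \<Rightarrow> real^'d \<Rightarrow> 'a \<Rightarrow> real" where
  "eta1 M f i = L2_partial M i (sqrt_emb f)"

definition gram :: "'a measure \<Rightarrow> (real^'d::finite \<Rightarrow> 'a \<Rightarrow> real) \<Rightarrow> real^'d \<Rightarrow> real^'d^'d" where
  "gram M f \<theta> = (\<chi> i j. L2_inner M (eta1 M f i \<theta>) (eta1 M f j \<theta>))"

definition fisher_info :: "'a measure \<Rightarrow> (real^'d::finite \<Rightarrow> 'a \<Rightarrow> real) \<Rightarrow> real^'d \<Rightarrow> real^'d^'d" where
  "fisher_info M f \<theta> = 4 *\<^sub>R gram M f \<theta>"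

definition tangent1 :: "'a measure \<Rightarrow> (real^'d::finite \<Rightarrow> 'a \<Rightarrow> real) \<Rightarrow> real^'d \<Rightarrow> ('a \<Rightarrow> real) set" where
  "tangent1 M f \<theta> = {\<lambda>x. \<Sum>i\<in>UNIV. c i * eta1 M f i \<theta> x | c. True}"

definition second_form ::
    "'a measure \<Rightarrow> (real^'d::finite \<Rightarrow> 'a \<Rightarrow> real) \<Rightarrow> real^'d \<Rightarrow> 'd \<times> 'd \<Rightarrow> 'a \<Rightarrow> real" where
  "second_form M f \<theta> = (\<lambda>(i, j) x.
     L2_partial M i (eta1 M f j) \<theta> x -
     L2_proj M (tangent1 M f \<theta>) (L2_partial M i (eta1 M f j) \<theta>) x)"

definition lifted_error ::
    "(real^'d \<Rightarrow> 'a \<Rightarrow> real) \<Rightarrow> ('a \<Rightarrow> real^'d::finite) \<Rightarrow> real^'d \<Rightarrow> 'd \<Rightarrow> 'a \<Rightarrow> real" where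
  "lifted_error f T \<theta> p x = (T x $ p - \<theta> $ p) * sqrt_emb f \<theta> x"


section \<open>The degree-6 form\<close>

text \<open>
  Vectors and matrices indexed by \<open>index_pairs\<close> (resp. by the cubic multi-indices below) are
  functions of one (resp. two) indices, of which only the values on that finite set matter.
\<close>

definition index_pairs :: "('d::{finite,linorder} \<times> 'd) set" where
  "index_pairs = {(i, j). i \<le> j}"

definition gram_N ::
    "'a measure \<Rightarrow> (real^'d::finite \<Rightarrow> 'a \<Rightarrow> real) \<Rightarrow> real^'d \<Rightarrow> 'd \<times> 'd \<Rightarrow> 'd \<times> 'd \<Rightarrow> real" where
  "gram_N M f \<theta> a b = L2_inner M (second_form M f \<theta> a) (second_form M f \<theta> b)"

definition cross_C ::
    "'a measure \<Rightarrow> (real^'d::finite \<Rightarrow> 'a \<Rightarrow> real) \<Rightarrow> ('a \<Rightarrow> real^'d) \<Rightarrow> real^'d \<Rightarrow> 'd \<Rightarrow> 'd \<times> 'd \<Rightarrow> real" where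
  "cross_C M f T \<theta> p a = L2_inner M (lifted_error f T \<theta> p) (second_form M f \<theta> a)"

definition delta_vec ::
    "'a measure \<Rightarrow> (real^'d::finite \<Rightarrow> 'a \<Rightarrow> real) \<Rightarrow> ('a \<Rightarrow> real^'d) \<Rightarrow> real^'d \<Rightarrow> real^'d \<Rightarrow> 'd \<times> 'd \<Rightarrow> real" where
  "delta_vec M f T \<theta> v a = (\<Sum>p\<in>UNIV. cross_C M f T \<theta> p a * v $ p)"

definition xi_vec ::
    "'a measure \<Rightarrow> (real^'d::finite \<Rightarrow> 'a \<Rightarrow> real) \<Rightarrow> real^'d \<Rightarrow> real^'d \<Rightarrow> 'd \<times> 'd \<Rightarrow> real" where
  "xi_vec M f \<theta> v = (\<lambda>(i, j).
     let w = matrix_inv (gram M f \<theta>) *v v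
     in if i = j then (w $ i)\<^sup>2 else 2 * w $ i * w $ j)"

definition P_form ::
    "'a measure \<Rightarrow> ('d::{finite,linorder} rvec \<Rightarrow> 'a \<Rightarrow> real) \<Rightarrow> ('a \<Rightarrow> 'd rvec) \<Rightarrow> 'd rvec \<Rightarrow>
     'd rmat \<Rightarrow> 'd rvec \<Rightarrow> real" where
  "P_form M f T \<theta> \<Delta> v =
     (\<Sum>a\<in>index_pairs. delta_vec M f T \<theta> v a * xi_vec M f \<theta> v a)\<^sup>2 -
     (v \<bullet> (\<Delta> *v v)) *
     (\<Sum>a\<in>index_pairs. \<Sum>b\<in>index_pairs. xi_vec M f \<theta> v a * gram_N M f \<theta> a b * xi_vec M f \<theta> v b)"

definition monomials :: "nat \<Rightarrow> ('d::finite \<Rightarrow> nat) set" where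
  "monomials n = {\<alpha>. mi_degree \<alpha> = n}"

definition monomial :: "('d::finite \<Rightarrow> nat) \<Rightarrow> real^'d \<Rightarrow> real" where
  "monomial \<alpha> v = (\<Prod>i\<in>UNIV. (v $ i) ^ \<alpha> i)"


section \<open>Symmetric and positive semidefinite matrices\<close>

definition symmetric_on :: "'i set \<Rightarrow> ('i \<Rightarrow> 'i \<Rightarrow> real) \<Rightarrow> bool" where
  "symmetric_on I S \<longleftrightarrow> (\<forall>a\<in>I. \<forall>b\<in>I. S a b = S b a)"

definition psd_on :: "'i set \<Rightarrow> ('i \<Rightarrow> 'i \<Rightarrow> real) \<Rightarrow> bool" where
  "psd_on I S \<longleftrightarrow> symmetric_on I S \<and> (\<forall>y. 0 \<le> (\<Sum>a\<in>I. \<Sum>b\<in>I. y a * S a b * y b))"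

definition psd :: "real^'n^'n \<Rightarrow> bool" where
  "psd A \<longleftrightarrow> transpose A = A \<and> (\<forall>y. 0 \<le> y \<bullet> (A *v y))"

definition loewner_ge :: "real^'n^'n \<Rightarrow> real^'n^'n \<Rightarrow> bool" where
  "loewner_ge A B \<longleftrightarrow> psd (A - B)"

end

theory Submission
  imports Defs
begin

text \<open>
  For a fixed \<open>v \<noteq> 0\<close> put \<open>Z = Z\<^sub>v\<close>, \<open>w = G\<^sup>-\<^sup>1 v\<close> and let \<open>N = \<Pi>\<^sub>v\<close> be the curvature vector. Unbiasedness and the
  interchange of derivative and integral give \<open>\<langle>Z\<^sup>(\<^sup>p\<^sup>), \<eta>\<^sub>i\<rangle> = \<delta>\<^sub>p\<^sub>i / 2\<close>, so the projection of \<open>Z\<close> to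
  the tangent space is \<open>\<Sum>\<^sub>i (w\<^sub>i / 2) \<eta>\<^sub>i\<close>, of squared norm \<open>v \<bullet> J\<^sup>-\<^sup>1 v\<close>. Since \<open>N\<close> is normal to the
  tangent space, the Cauchy--Schwarz inequality for the residual and \<open>N\<close> reads
  \<open>\<langle>Z, N\<rangle>\<^sup>2 \<le> (v \<bullet> (\<Sigma> - J\<^sup>-\<^sup>1) v) \<parallel>N\<parallel>\<^sup>2\<close>. A representation of \<open>P\<^sub>\<Delta>\<close> by a positive semidefinite \<open>S\<close>
  makes \<open>P\<^sub>\<Delta>(v) = \<langle>Z, N\<rangle>\<^sup>2 - (v \<bullet> \<Delta> v) \<parallel>N\<parallel>\<^sup>2\<close> nonnegative, and \<open>\<parallel>N\<parallel> > 0\<close> because the Gram matrix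
  of order \<open>2\<close> is positive definite and some coefficient \<open>w\<^sub>i\<^sup>2\<close> of \<open>N\<close> is nonzero.
\<close>

section \<open>Inverse matrices\<close>

lemma matrix_inv_inverse:
  fixes A :: "real^'n^'n"
  assumes "invertible A"
  shows "A ** matrix_inv A = mat 1" "matrix_inv A ** A = mat 1"
  using someI_ex[OF assms[unfolded invertible_def]] unfolding matrix_inv_def by auto

text \<open>For square matrices a right inverse already makes \<open>A\<close> invertible;
  multiplying \<open>A ** B = mat 1\<close> on the left by the inverse chosen by
  \<open>matrix_inv\<close> identifies that choice with \<open>B\<close>.\<close>

lemma matrix_inv_unique:
  fixes A B :: "real^'n^'n"
  assumes "A ** B = mat 1"
  shows "matrix_inv A = B"
proof -
  have "invertible A"
    using assms invertible_right_inverse by blast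
  then have "matrix_inv A ** (A ** B) = B"
    by (simp add: matrix_mul_assoc matrix_inv_inverse)
  with assms show ?thesis by simp
qed

lemma matrix_inv_scaleR:
  fixes A :: "real^'n^'n"
  assumes "invertible A" "c \<noteq> 0"
  shows "matrix_inv (c *\<^sub>R A) = (1 / c) *\<^sub>R matrix_inv A"
  using assms
  by (intro matrix_inv_unique)
    (simp add: matrix_inv_inverse scalar_matrix_assoc matrix_scalar_ac flip: scalar_mult_eq_scaleR)

lemma transpose_matrix_inv:
  fixes A :: "real^'n^'n"
  assumes "invertible A"
  shows "transpose (matrix_inv A) = matrix_inv (transpose A)"
  using matrix_inv_inverse(2)[OF assms]
  by (intro matrix_inv_unique[symmetric]) (simp flip: matrix_transpose_mul)

section \<open>Inner product geometry of square-integrable functions\<close>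

lemma L2_measurable: "u \<in> L2 M \<Longrightarrow> u \<in> borel_measurable M"
  by (simp add: L2_def)

text \<open>Domination by the sum of the two squares. This is what licenses additivity of
  \<open>L2_inner\<close>, which could fail with a Bochner integral that is 0 on non-integrable
  functions.\<close>

lemma L2_mult_integrable:
  assumes "u \<in> L2 M" "w \<in> L2 M"
  shows "integrable M (\<lambda>x. u x * w x)"
proof (rule Bochner_Integration.integrable_bound)
  show "integrable M (\<lambda>x. (u x)\<^sup>2 + (w x)\<^sup>2)"
    using assms by (auto simp: L2_def)
  show "(\<lambda>x. u x * w x) \<in> borel_measurable M"
    using assms by (auto simp: L2_def)
  have "\<bar>a * b\<bar> \<le> a\<^sup>2 + b\<^sup>2" for a b :: real
    using sum_squares_bound[of a b] sum_squares_bound[of a "-b"] by (auto simp: abs_if)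
  then show "AE x in M. norm (u x * w x) \<le> norm ((u x)\<^sup>2 + (w x)\<^sup>2)"
    by simp
qed

lemma L2_cmult:
  assumes "u \<in> L2 M"
  shows "(\<lambda>x. c * u x) \<in> L2 M"
  using assms by (auto simp: L2_def power_mult_distrib)

lemma L2_add:
  assumes "u \<in> L2 M" "w \<in> L2 M"
  shows "(\<lambda>x. u x + w x) \<in> L2 M"
proof -
  have "integrable M (\<lambda>x. (u x)\<^sup>2 + (w x)\<^sup>2 + 2 * (u x * w x))"
    using assms L2_mult_integrable[OF assms] by (auto simp: L2_def)
  then show ?thesis
    using assms by (auto simp: L2_def power2_sum mult.assoc)
qed

lemma L2_diff:
  assumes "u \<in> L2 M" "w \<in> L2 M"
  shows "(\<lambda>x. u x - w x) \<in> L2 M"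
  using L2_add[OF assms(1) L2_cmult[OF assms(2), of "-1"]] by simp

lemma L2_sum:
  assumes "\<And>i. i \<in> I \<Longrightarrow> u i \<in> L2 M"
  shows "(\<lambda>x. \<Sum>i\<in>I. c i * u i x) \<in> L2 M"
  using assms
proof (induction I rule: infinite_finite_induct)
  case (insert i I)
  then have "(\<lambda>x. c i * u i x + (\<Sum>i\<in>I. c i * u i x)) \<in> L2 M"
    by (intro L2_add L2_cmult) auto
  with insert show ?case by simp
qed (auto simp: L2_def)

lemma L2_inner_commute: "L2_inner M u w = L2_inner M w u"
  by (simp add: L2_inner_def mult.commute)

lemma L2_inner_diff_left:
  assumes "u \<in> L2 M" "u' \<in> L2 M" "w \<in> L2 M"
  shows "L2_inner M (\<lambda>x. u x - u' x) w = L2_inner M u w - L2_inner M u' w"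
  using L2_mult_integrable[OF assms(1,3)] L2_mult_integrable[OF assms(2,3)]
  by (simp add: L2_inner_def left_diff_distrib)

lemma L2_inner_cmult_left: "L2_inner M (\<lambda>x. c * u x) w = c * L2_inner M u w"
  by (simp add: L2_inner_def mult.assoc)

lemma L2_inner_sum_left:
  assumes "\<And>i. i \<in> I \<Longrightarrow> u i \<in> L2 M" "w \<in> L2 M"
  shows "L2_inner M (\<lambda>x. \<Sum>i\<in>I. c i * u i x) w = (\<Sum>i\<in>I. c i * L2_inner M (u i) w)"
proof -
  have "L2_inner M (\<lambda>x. \<Sum>i\<in>I. c i * u i x) w = (\<integral>x. (\<Sum>i\<in>I. c i * (u i x * w x)) \<partial>M)"
    by (simp add: L2_inner_def sum_distrib_right mult.assoc)
  also have "\<dots> = (\<Sum>i\<in>I. c i * L2_inner M (u i) w)"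
    using L2_mult_integrable assms
    by (subst Bochner_Integration.integral_sum) (auto simp: L2_inner_def)
  finally show ?thesis .
qed

lemma L2_inner_sum_right:
  assumes "\<And>i. i \<in> I \<Longrightarrow> u i \<in> L2 M" "w \<in> L2 M"
  shows "L2_inner M w (\<lambda>x. \<Sum>i\<in>I. c i * u i x) = (\<Sum>i\<in>I. c i * L2_inner M w (u i))"
  using L2_inner_sum_left[OF assms] by (simp add: L2_inner_commute)

lemma L2_inner_sum_sum:
  assumes "\<And>i. i \<in> I \<Longrightarrow> u i \<in> L2 M" "\<And>j. j \<in> J \<Longrightarrow> w j \<in> L2 M"
  shows "L2_inner M (\<lambda>x. \<Sum>i\<in>I. a i * u i x) (\<lambda>x. \<Sum>j\<in>J. b j * w j x)
           = (\<Sum>i\<in>I. \<Sum>j\<in>J. a i * L2_inner M (u i) (w j) * b j)"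
proof -
  have "L2_inner M (\<lambda>x. \<Sum>i\<in>I. a i * u i x) (\<lambda>x. \<Sum>j\<in>J. b j * w j x)
      = (\<Sum>i\<in>I. a i * (\<Sum>j\<in>J. b j * L2_inner M (u i) (w j)))"
    using assms by (simp add: L2_inner_sum_left L2_inner_sum_right L2_sum)
  then show ?thesis
    by (simp add: sum_distrib_left mult_ac)
qed

lemma L2_inner_self_nonneg: "0 \<le> L2_inner M u u"
  by (auto simp: L2_inner_def intro!: integral_nonneg_AE)

lemma L2_inner_self_eq: "L2_inner M u u = (\<integral>x. (u x)\<^sup>2 \<partial>M)"
  by (simp add: L2_inner_def power2_eq_square)

lemma L2_nrm_eq: "L2_nrm M u = sqrt (\<integral>x. (u x)\<^sup>2 \<partial>M)"
  by (simp add: L2_nrm_def L2_inner_self_eq)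

text \<open>The squared norm of \<open>u - t n\<close> is a quadratic polynomial in \<open>t\<close>
  that never becomes negative (fact \<open>q\<close>). Since \<open>L2_inner\<close> is only
  semidefinite on representatives, \<open>?c = 0\<close> is a separate case.\<close>

lemma L2_cauchy_schwarz:
  assumes "u \<in> L2 M" "n \<in> L2 M"
  shows "(L2_inner M u n)\<^sup>2 \<le> L2_inner M u u * L2_inner M n n"
proof -
  let ?a = "L2_inner M u u" and ?b = "L2_inner M u n" and ?c = "L2_inner M n n"
  have tn: "(\<lambda>x. t * n x) \<in> L2 M" for t
    using assms by (rule_tac L2_cmult)
  have q: "0 \<le> ?a - 2 * t * ?b + t\<^sup>2 * ?c" for t
  proof -
    have "0 \<le> L2_inner M (\<lambda>x. u x - t * n x) (\<lambda>x. u x - t * n x)"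
      by (rule L2_inner_self_nonneg)
    also have "\<dots> = L2_inner M (\<lambda>x. u x - t * n x) u - L2_inner M (\<lambda>x. u x - t * n x) (\<lambda>x. t * n x)"
      using L2_inner_diff_left[OF assms(1) tn L2_diff[OF assms(1) tn]]
      by (simp add: L2_inner_commute)
    also have "\<dots> = ?a - 2 * t * ?b + t\<^sup>2 * ?c"
    proof -
      have "L2_inner M (\<lambda>x. u x - t * n x) (\<lambda>x. t * n x) = t * L2_inner M (\<lambda>x. u x - t * n x) n"
        by (simp add: L2_inner_commute[of M "\<lambda>x. u x - t * n x"] L2_inner_cmult_left)
      then show ?thesis
        using assms tn
        by (simp add: L2_inner_diff_left L2_inner_cmult_left L2_inner_commute[of M n u]
            power2_eq_square algebra_simps)
    qed
    finally show ?thesis .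
  qed
  show ?thesis
  proof (cases "?c = 0")
    case True
    have "?b = 0"
    proof (rule ccontr)
      assume "?b \<noteq> 0"
      \<comment> \<open>For \<open>?c = 0\<close> the polynomial is affine in \<open>t\<close>, and
        this \<open>t\<close> gives it the value -1.\<close>
      then show False
        using q[of "(?a + 1) / (2 * ?b)"] True by simp
    qed
    then show ?thesis by (simp add: True)
  next
    case False
    then have "?c > 0"
      using L2_inner_self_nonneg[of M n] by simp
    \<comment> \<open>\<open>?b / ?c\<close> is the minimiser of the quadratic.\<close>
    then show ?thesis
      using q[of "?b / ?c"] by (simp add: field_simps power2_eq_square)
  qed
qed

text \<open>Cauchy-Schwarz is applied to \<open>n\<close> and the residual of \<open>z\<close> after
  projection to the span of the \<open>e i\<close>. Passing to the residual leaves the inner product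
  with \<open>n\<close> unchanged, because \<open>n\<close> is orthogonal to the span, and lowers
  the squared norm of \<open>z\<close> by that of the projection.\<close>

lemma L2_projected_cauchy_schwarz:
  fixes e :: "'d::finite \<Rightarrow> 'a \<Rightarrow> real" and v w :: "real^'d"
  assumes L2: "z \<in> L2 M" "n \<in> L2 M" "\<And>i. e i \<in> L2 M"
    and ze: "\<And>i. L2_inner M z (e i) = v $ i / 2"
    and ne: "\<And>i. L2_inner M n (e i) = 0"
    and w: "(\<chi> i j. L2_inner M (e i) (e j)) *v w = v"
  shows "(L2_inner M z n)\<^sup>2 \<le> (L2_inner M z z - (v \<bullet> w) / 4) * L2_inner M n n"
proof -
  \<comment> \<open>The projection of \<open>z\<close>: its coefficients solve the normal equations,
    whose right-hand side is \<open>v / 2\<close> by \<open>ze\<close>, and the Gram matrix sends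
    \<open>w / 2\<close> to \<open>v / 2\<close> by \<open>w\<close>.\<close>
  define q where "q = (\<lambda>x. \<Sum>i\<in>UNIV. (w $ i / 2) * e i x)"
  have q: "q \<in> L2 M"
    unfolding q_def by (rule L2_sum) (rule L2)
  have zq: "L2_inner M z q = (v \<bullet> w) / 4"
    using L2_inner_sum_right[of UNIV e M z "\<lambda>i. w $ i / 2"] L2
    by (simp add: q_def ze inner_vec_def sum_divide_distrib mult_ac)
  have eq: "L2_inner M (e i) q = v $ i / 2" for i
  proof -
    have "L2_inner M (e i) q = (\<Sum>j\<in>UNIV. L2_inner M (e i) (e j) * w $ j) / 2"
      using L2_inner_sum_right[of UNIV e M "e i" "\<lambda>i. w $ i / 2"] L2
      by (simp add: q_def sum_divide_distrib mult_ac)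
    also have "(\<Sum>j\<in>UNIV. L2_inner M (e i) (e j) * w $ j) = v $ i"
      by (subst w[symmetric]) (simp add: matrix_vector_mult_def)
    finally show ?thesis .
  qed
  have qq: "L2_inner M q q = (v \<bullet> w) / 4"
    using L2_inner_sum_left[of UNIV e M q "\<lambda>i. w $ i / 2", folded q_def] L2 q
    by (simp add: eq inner_vec_def sum_divide_distrib mult_ac)
  have qn: "L2_inner M q n = 0"
    using L2_inner_sum_left[of UNIV e M n "\<lambda>i. w $ i / 2"] L2
    by (simp add: q_def L2_inner_commute[of M _ n] ne)
  have r: "(\<lambda>x. z x - q x) \<in> L2 M"
    using L2 q by (intro L2_diff)
  have "L2_inner M z (\<lambda>x. z x - q x) = L2_inner M z z - (v \<bullet> w) / 4"
    using L2_inner_diff_left[OF L2(1) q L2(1)] zq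
    by (simp only: L2_inner_commute[of M z "\<lambda>x. z x - q x"] L2_inner_commute[of M q z])
  moreover have "L2_inner M q (\<lambda>x. z x - q x) = 0"
    using L2_inner_diff_left[OF L2(1) q q] zq qq
    by (simp only: L2_inner_commute[of M q "\<lambda>x. z x - q x"])
  ultimately have "L2_inner M (\<lambda>x. z x - q x) (\<lambda>x. z x - q x) = L2_inner M z z - (v \<bullet> w) / 4"
    using L2_inner_diff_left[OF L2(1) q r] by simp
  moreover have "L2_inner M (\<lambda>x. z x - q x) n = L2_inner M z n"
    using L2 q by (simp add: L2_inner_diff_left qn)
  ultimately show ?thesis
    using L2_cauchy_schwarz[OF r L2(2)] by simp
qed

text \<open>\<open>L2_proj\<close> is a choice, so its defining property becomes available only
  after some projection has been exhibited. Invertibility of the Gram matrix supplies one; the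
  function actually chosen may have other coefficients \<open>c\<close>, but satisfies the same
  orthogonality.\<close>

lemma L2_proj_span:
  fixes e :: "'d::finite \<Rightarrow> 'a \<Rightarrow> real"
  assumes L2: "u \<in> L2 M" "\<And>i. e i \<in> L2 M"
    and inv: "invertible (\<chi> i j. L2_inner M (e i) (e j))"
  obtains c where "L2_proj M {\<lambda>x. \<Sum>i\<in>UNIV. c i * e i x | c. True} u = (\<lambda>x. \<Sum>i\<in>UNIV. c i * e i x)"
    and "\<And>i. L2_inner M (\<lambda>x. u x - (\<Sum>i\<in>UNIV. c i * e i x)) (e i) = 0"
proof -
  let ?G = "\<chi> i j. L2_inner M (e i) (e j)"
  let ?V = "{\<lambda>x. \<Sum>i\<in>UNIV. c i * e i x | c. True}"
  let ?Q = "\<lambda>w. w \<in> ?V \<and> (\<forall>y\<in>?V. L2_inner M (\<lambda>x. u x - w x) y = 0)"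
  define b where "b = (\<chi> i. L2_inner M u (e i))"
  \<comment> \<open>Solution of the normal equations for the projection of \<open>u\<close>.\<close>
  define a where "a = matrix_inv ?G *v b"
  have "?G *v a = b"
    using matrix_inv_inverse(1)[OF inv] by (simp add: a_def matrix_vector_mul_assoc)
  then have Ga: "(\<Sum>j\<in>UNIV. L2_inner M (e i) (e j) * a $ j) = L2_inner M u (e i)" for i
    by (auto simp: vec_eq_iff b_def matrix_vector_mult_def)
  have V: "y \<in> ?V \<Longrightarrow> y \<in> L2 M" for y
    using L2 by (auto intro: L2_sum)
  let ?w = "\<lambda>x. \<Sum>i\<in>UNIV. a $ i * e i x"
  have "?Q ?w"
  proof (intro conjI ballI)
    show w: "?w \<in> ?V" by auto
    fix y assume y: "y \<in> ?V"
    then obtain d where d: "y = (\<lambda>x. \<Sum>i\<in>UNIV. d i * e i x)" by auto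
    have "L2_inner M (\<lambda>x. u x - ?w x) (e i) = 0" for i
      using L2_inner_sum_left[of UNIV e M "e i" "\<lambda>j. a $ j"] L2 V[OF w] Ga[of i]
      by (simp add: L2_inner_diff_left L2_inner_commute[of M "e i"] mult.commute)
    then show "L2_inner M (\<lambda>x. u x - ?w x) y = 0"
      unfolding d using L2 V[OF w] by (simp add: L2_inner_sum_right L2_diff)
  qed
  then have Q: "?Q (L2_proj M ?V u)"
    unfolding L2_proj_def by (rule someI[of ?Q])
  then obtain c where c: "L2_proj M ?V u = (\<lambda>x. \<Sum>i\<in>UNIV. c i * e i x)" by blast
  have V_e: "e i \<in> ?V" for i
    by (rule CollectI, rule exI[of _ "\<lambda>j. if j = i then 1 else 0"]) (simp add: if_distrib[of "\<lambda>c. c * _"] cong: if_cong)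
  have "\<forall>y\<in>?V. L2_inner M (\<lambda>x. u x - (\<Sum>i\<in>UNIV. c i * e i x)) y = 0"
    using Q unfolding c by (rule conjunct2)
  then have "L2_inner M (\<lambda>x. u x - (\<Sum>i\<in>UNIV. c i * e i x)) (e i) = 0" for i
    by (rule bspec[OF _ V_e])
  with c show thesis by (rule that)
qed

section \<open>Derivatives in mean square\<close>

lemma L2_tendsto_integral:
  assumes "L2_tendsto M u w F"
  shows "((\<lambda>t. \<integral>x. (u t x - w x)\<^sup>2 \<partial>M) \<longlongrightarrow> 0) F"
proof -
  have "((\<lambda>t. (L2_nrm M (\<lambda>x. u t x - w x))\<^sup>2) \<longlongrightarrow> 0) F"
    using assms tendsto_power[of _ 0 F 2] by (auto simp: L2_tendsto_def)
  then show ?thesis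
    by (simp add: L2_nrm_eq)
qed

text \<open>The squared distance of the two limits is squeezed to 0 by twice the sum of their
  squared distances to \<open>u t\<close>.\<close>

lemma L2_tendsto_unique:
  assumes "L2_tendsto M u w F" "L2_tendsto M u w' F" "F \<noteq> bot"
  shows "AE x in M. w x = w' x"
proof -
  have w: "w \<in> L2 M" "w' \<in> L2 M"
    using assms by (auto simp: L2_tendsto_def)
  have ev: "\<forall>\<^sub>F t in F. u t \<in> L2 M"
    using assms by (auto simp: L2_tendsto_def)
  let ?I = "\<integral>x. (w x - w' x)\<^sup>2 \<partial>M"
  have int: "integrable M (\<lambda>x. (v x)\<^sup>2)" if "v \<in> L2 M" for v
    using that by (simp add: L2_def)
  have "\<forall>\<^sub>F t in F. ?I \<le> 2 * (\<integral>x. (u t x - w x)\<^sup>2 \<partial>M) + 2 * (\<integral>x. (u t x - w' x)\<^sup>2 \<partial>M)"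
    using ev
  proof eventually_elim
    case (elim t)
    have "?I \<le> (\<integral>x. 2 * (u t x - w x)\<^sup>2 + 2 * (u t x - w' x)\<^sup>2 \<partial>M)"
    proof (rule integral_mono)
      show "(w x - w' x)\<^sup>2 \<le> 2 * (u t x - w x)\<^sup>2 + 2 * (u t x - w' x)\<^sup>2" for x
        \<comment> \<open>The right side minus the left side is exactly this square.\<close>
        using zero_le_power2[of "(u t x - w x) + (u t x - w' x)"]
        by (simp add: power2_eq_square algebra_simps)
    qed (use elim w in \<open>auto intro!: int L2_diff\<close>)
    also have "\<dots> = 2 * (\<integral>x. (u t x - w x)\<^sup>2 \<partial>M) + 2 * (\<integral>x. (u t x - w' x)\<^sup>2 \<partial>M)"
      using elim w by (subst Bochner_Integration.integral_add) (auto intro!: int L2_diff)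
    finally show ?case .
  qed
  moreover have "((\<lambda>t. 2 * (\<integral>x. (u t x - w x)\<^sup>2 \<partial>M) + 2 * (\<integral>x. (u t x - w' x)\<^sup>2 \<partial>M)) \<longlongrightarrow> 2 * 0 + 2 * 0) F"
    using assms by (intro tendsto_intros L2_tendsto_integral)
  ultimately have "?I \<le> 0"
    using tendsto_lowerbound[OF _ _ assms(3)] by fastforce
  then have "?I = 0"
    by (simp add: order_antisym)
  then have "AE x in M. (w x - w' x)\<^sup>2 = 0"
    using int[OF L2_diff[OF w]] by (subst (asm) integral_nonneg_eq_0_iff_AE) auto
  then show ?thesis by simp
qed

text \<open>Convergence in mean square gives almost everywhere convergence along a subsequence.\<close>

lemma L2_tendsto_pointwise:
  fixes u :: "real \<Rightarrow> 'a \<Rightarrow> real"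
  assumes L2: "L2_tendsto M u w (at 0)"
    and pw: "\<And>x. x \<in> space M \<Longrightarrow> ((\<lambda>t. u t x) \<longlongrightarrow> g x) (at 0)"
  shows "AE x in M. w x = g x"
proof -
  have w: "w \<in> L2 M" using L2 by (simp add: L2_tendsto_def)
  have ev: "\<forall>\<^sub>F t in at 0. u t \<in> L2 M"
    using L2 by (simp add: L2_tendsto_def)
  have seq: "filterlim (\<lambda>n. 1 / real (Suc n)) (at 0) sequentially"
    using LIMSEQ_inverse_real_of_nat by (auto simp: filterlim_at inverse_eq_divide)
  obtain N where N: "\<And>n. n \<ge> N \<Longrightarrow> u (1 / real (Suc n)) \<in> L2 M"
    using eventually_compose_filterlim[OF ev seq] by (auto simp: eventually_sequentially)
  \<comment> \<open>The shift by \<open>N\<close> puts every term of the sequence in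
    \<open>L2 M\<close>, since the subsequence theorem asks for integrability at all
    \<open>n\<close> and not just eventually.\<close>
  define s where "s n = 1 / real (Suc (n + N))" for n
  have s: "filterlim s (at 0) sequentially"
    unfolding s_def using filterlim_compose[OF seq filterlim_add_const_nat_at_top[of N]] by simp
  have sL2: "u (s n) \<in> L2 M" for n
    unfolding s_def by (rule N) simp
  have lim: "(\<lambda>n. \<integral>x. norm ((u (s n) x - w x)\<^sup>2) \<partial>M) \<longlonglongrightarrow> 0"
    using filterlim_compose[OF L2_tendsto_integral[OF L2] s] by simp
  have "integrable M (\<lambda>x. (u (s n) x - w x)\<^sup>2)" for n
    using L2_diff[OF sL2 w] by (simp add: L2_def)
  then obtain r :: "nat \<Rightarrow> nat" where r: "strict_mono r"
    and ae: "AE x in M. (\<lambda>n. (u (s (r n)) x - w x)\<^sup>2) \<longlonglongrightarrow> 0"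
    using tendsto_L1_AE_subseq[OF _ lim] by auto
  show ?thesis
    using ae AE_space
  proof eventually_elim
    case (elim x)
    have "(\<lambda>n. u (s (r n)) x) \<longlonglongrightarrow> g x"
      using filterlim_compose[OF pw[OF elim(2)] filterlim_compose[OF s filterlim_subseq[OF r]]]
      by simp
    then have "(\<lambda>n. (u (s (r n)) x - w x)\<^sup>2) \<longlonglongrightarrow> (g x - w x)\<^sup>2"
      by (intro tendsto_intros)
    with elim(1) have "(g x - w x)\<^sup>2 = 0"
      using LIMSEQ_unique by blast
    then show ?case by simp
  qed
qed

text \<open>Restricting the Frechet expansion to increments \<open>t *\<^sub>R axis i 1\<close> and
  dividing by \<open>t\<close> gives convergence of the difference quotients. The map
  \<open>u\<close> is allowed to differ from \<open>D \<theta> vs\<close> on null sets because the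
  derivatives picked by \<open>L2_partial\<close> are determined only up to such sets.\<close>

lemma L2_tendsto_partial:
  fixes u :: "real^'d \<Rightarrow> 'a \<Rightarrow> real" and D :: "real^'d \<Rightarrow> (real^'d) list \<Rightarrow> 'a \<Rightarrow> real"
  assumes ml: "\<And>\<theta>. \<theta> \<in> \<Theta> \<Longrightarrow> L2_bounded_multilinear M k (D \<theta>)"
      "L2_bounded_multilinear M (Suc k) (D \<theta>)"
    and D: "\<And>\<epsilon>. \<epsilon> > 0 \<Longrightarrow> \<forall>\<^sub>F h in at 0. L2_nrm M (\<lambda>x. D (\<theta> + h) vs x - D \<theta> vs x - D \<theta> (h # vs) x) \<le> \<epsilon> * norm h"
    and \<Theta>: "open \<Theta>" "\<theta> \<in> \<Theta>" and vs: "length vs = k"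
    and u: "\<And>\<theta>. \<theta> \<in> \<Theta> \<Longrightarrow> u \<theta> \<in> L2 M" "\<And>\<theta>. \<theta> \<in> \<Theta> \<Longrightarrow> AE x in M. u \<theta> x = D \<theta> vs x"
  shows "L2_tendsto M (\<lambda>t x. (u (\<theta> + t *\<^sub>R axis i 1) x - u \<theta> x) / t) (D \<theta> (axis i 1 # vs)) (at 0)"
proof -
  define e :: "real^'d" where "e = axis i 1"
  have ne: "norm e = 1" by (simp add: e_def norm_axis_1)
  have path: "filterlim (\<lambda>t. t *\<^sub>R e) (at 0) (at (0::real))"
    unfolding filterlim_at using ne
    by (auto intro!: tendsto_eq_intros simp: eventually_at_filter)
  have "((\<lambda>t::real. \<theta> + t *\<^sub>R e) \<longlongrightarrow> \<theta>) (at 0)"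
    by (auto intro!: tendsto_eq_intros)
  then have inT: "\<forall>\<^sub>F t::real in at 0. \<theta> + t *\<^sub>R e \<in> \<Theta>"
    using topological_tendstoD \<Theta> by blast
  have DL2: "D \<theta> (h # vs) \<in> L2 M" for h
    using ml(2) vs by (auto simp: L2_bounded_multilinear_def)
  have Dvs: "D \<theta>' vs \<in> L2 M" if "\<theta>' \<in> \<Theta>" for \<theta>'
    using ml(1)[OF that] vs by (auto simp: L2_bounded_multilinear_def)
  \<comment> \<open>Homogeneity in the first slot is linearity with second coefficient 0.\<close>
  have scale: "AE x in M. D \<theta> ((t *\<^sub>R e) # vs) x = t * D \<theta> (e # vs) x" for t
  proof -
    have "AE x in M. D \<theta> ((e # vs)[0 := t *\<^sub>R e + 0 *\<^sub>R e]) x =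
            t * D \<theta> ((e # vs)[0 := e]) x + 0 * D \<theta> ((e # vs)[0 := e]) x"
      by (rule ml(2)[unfolded L2_bounded_multilinear_def, THEN conjunct2, THEN conjunct1, rule_format])
        (use vs in auto)
    then show ?thesis by simp
  qed
  have bound: "\<forall>\<^sub>F t in at 0. L2_nrm M (\<lambda>x. (u (\<theta> + t *\<^sub>R e) x - u \<theta> x) / t - D \<theta> (e # vs) x) \<le> \<epsilon>"
    if "\<epsilon> > 0" for \<epsilon>
    using eventually_compose_filterlim[OF D[OF that] path] inT eventually_neq_at_within[of 0]
  proof eventually_elim
    case (elim t)
    let ?R = "\<lambda>x. D (\<theta> + t *\<^sub>R e) vs x - D \<theta> vs x - D \<theta> ((t *\<^sub>R e) # vs) x"
    let ?q = "\<lambda>x. (u (\<theta> + t *\<^sub>R e) x - u \<theta> x) / t - D \<theta> (e # vs) x"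
    have ae: "AE x in M. (?q x)\<^sup>2 = (?R x)\<^sup>2 / t\<^sup>2"
      using u(2)[OF elim(2)] u(2)[OF \<Theta>(2)] scale[of t]
    proof eventually_elim
      case (elim x)
      have "?q x = ?R x / t"
        using \<open>t \<noteq> 0\<close> elim by (simp add: field_simps)
      then show ?case by (simp add: power_divide)
    qed
    have [measurable]: "u (\<theta> + t *\<^sub>R e) \<in> borel_measurable M" "u \<theta> \<in> borel_measurable M"
      "D (\<theta> + t *\<^sub>R e) vs \<in> borel_measurable M" "D \<theta> vs \<in> borel_measurable M"
      "D \<theta> (e # vs) \<in> borel_measurable M" "D \<theta> ((t *\<^sub>R e) # vs) \<in> borel_measurable M"
      using u(1) Dvs DL2 elim \<Theta> by (auto intro: L2_measurable)
    have "(\<integral>x. (?q x)\<^sup>2 \<partial>M) = (\<integral>x. (?R x)\<^sup>2 / t\<^sup>2 \<partial>M)"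
      by (rule integral_cong_AE[OF _ _ ae]) measurable
    then have "L2_nrm M ?q = L2_nrm M ?R / \<bar>t\<bar>"
      by (simp add: L2_nrm_eq real_sqrt_divide)
    also have "\<dots> \<le> \<epsilon>"
      using elim ne by (simp add: pos_divide_le_eq)
    finally show ?case .
  qed
  show ?thesis
    unfolding L2_tendsto_def e_def[symmetric]
  proof (intro conjI)
    show "\<forall>\<^sub>F t in at 0. (\<lambda>x. (u (\<theta> + t *\<^sub>R e) x - u \<theta> x) / t) \<in> L2 M"
      using inT
    proof eventually_elim
      case (elim t)
      show ?case
        using L2_cmult[OF L2_diff[OF u(1)[OF elim] u(1)[OF \<Theta>(2)]], of "1/t"] by simp
    qed
    show "((\<lambda>t. L2_nrm M (\<lambda>x. (u (\<theta> + t *\<^sub>R e) x - u \<theta> x) / t - D \<theta> (e # vs) x)) \<longlongrightarrow> 0) (at 0)"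
    proof (rule tendstoI)
      fix \<epsilon> :: real assume "\<epsilon> > 0"
      \<comment> \<open>\<open>bound\<close> is not strict whereas \<open>tendstoI\<close> asks for
        a strict inequality, hence the half.\<close>
      then have "\<epsilon> / 2 > 0" by simp
      from bound[OF this] show "\<forall>\<^sub>F t in at 0. dist (L2_nrm M (\<lambda>x. (u (\<theta> + t *\<^sub>R e) x - u \<theta> x) / t - D \<theta> (e # vs) x)) 0 < \<epsilon>"
      proof eventually_elim
        case (elim t)
        with \<open>\<epsilon> > 0\<close> show ?case by (simp add: L2_nrm_eq)
      qed
    qed
  qed (rule DL2)
qed

text \<open>Any limit \<open>w\<close> certifies that the choice inside \<open>L2_partial\<close> is
  itself a limit.\<close>

lemma L2_tendsto_L2_partial:
  assumes "L2_tendsto M (\<lambda>t x. (u (\<theta> + t *\<^sub>R axis i 1) x - u \<theta> x) / t) w (at 0)" (is "?P w")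
  shows "L2_tendsto M (\<lambda>t x. (u (\<theta> + t *\<^sub>R axis i 1) x - u \<theta> x) / t) (L2_partial M i u \<theta>) (at 0)"
  unfolding L2_partial_def by (rule someI[of ?P, OF assms])

text \<open>Links the iterated choices made by \<open>L2_partial\<close> to the multilinear
  derivatives \<open>D\<close> evaluated at axis vectors. Each choice may leave \<open>D\<close> on
  a null set, and uniqueness of mean-square limits keeps the two equal almost everywhere along the
  list.\<close>

lemma L2_partial_iterated:
  fixes s :: "real^'d::finite \<Rightarrow> 'a \<Rightarrow> real"
  assumes diff: "L2_frechet_differentiable M m \<Theta> s" and "open \<Theta>"
  shows "length js \<le> m \<Longrightarrow> \<theta> \<in> \<Theta> \<Longrightarrow> foldr (L2_partial M) js s \<theta> \<in> L2 M"
    and "length js < m \<Longrightarrow> \<theta> \<in> \<Theta> \<Longrightarrow>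
      L2_tendsto M (\<lambda>t x. (foldr (L2_partial M) js s (\<theta> + t *\<^sub>R axis i 1) x - foldr (L2_partial M) js s \<theta> x) / t)
        (L2_partial M i (foldr (L2_partial M) js s) \<theta>) (at 0)"
proof -
  obtain D where D0: "\<forall>\<theta>\<in>\<Theta>. D \<theta> [] = s \<theta>"
    and ml: "\<forall>k\<le>m. \<forall>\<theta>\<in>\<Theta>. L2_bounded_multilinear M k (D \<theta>)"
    and D: "\<forall>k<m. \<forall>\<theta>\<in>\<Theta>. \<forall>\<epsilon>>0. \<forall>\<^sub>F h in at 0. \<forall>vs. length vs = k \<and> (\<forall>v\<in>set vs. norm v \<le> 1) \<longrightarrow>
           L2_nrm M (\<lambda>x. D (\<theta> + h) vs x - D \<theta> vs x - D \<theta> (h # vs) x) \<le> \<epsilon> * norm h"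
    using diff unfolding L2_frechet_differentiable_def by (elim exE conjE) (rule that)
  let ?E = "map (\<lambda>i. axis i (1::real) :: real^'d)"
  let ?F = "\<lambda>js. foldr (L2_partial M) js s"
  have step: "L2_tendsto M (\<lambda>t x. (?F js (\<theta> + t *\<^sub>R axis i 1) x - ?F js \<theta> x) / t) (D \<theta> (axis i 1 # ?E js)) (at 0)"
    if F: "\<And>\<theta>. \<theta> \<in> \<Theta> \<Longrightarrow> ?F js \<theta> \<in> L2 M" "\<And>\<theta>. \<theta> \<in> \<Theta> \<Longrightarrow> AE x in M. ?F js \<theta> x = D \<theta> (?E js) x"
      and js: "length js < m" and \<theta>: "\<theta> \<in> \<Theta>" for i js \<theta>
  proof (rule L2_tendsto_partial[where D = D and u = "?F js" and vs = "?E js" and k = "length js",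
        OF _ _ _ \<open>open \<Theta>\<close> \<theta> _ F])
    show "L2_bounded_multilinear M (length js) (D \<theta>)" if "\<theta> \<in> \<Theta>" for \<theta>
      using ml js that by simp
    show "L2_bounded_multilinear M (Suc (length js)) (D \<theta>)"
      using ml js \<theta> by simp
    fix \<epsilon> :: real assume "\<epsilon> > 0"
    with D js \<theta> have "\<forall>\<^sub>F h in at 0. \<forall>vs. length vs = length js \<and> (\<forall>v\<in>set vs. norm v \<le> 1) \<longrightarrow>
           L2_nrm M (\<lambda>x. D (\<theta> + h) vs x - D \<theta> vs x - D \<theta> (h # vs) x) \<le> \<epsilon> * norm h"
      by simp
    then show "\<forall>\<^sub>F h in at 0. L2_nrm M (\<lambda>x. D (\<theta> + h) (?E js) x - D \<theta> (?E js) x - D \<theta> (h # ?E js) x) \<le> \<epsilon> * norm h"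
      by eventually_elim (auto simp: norm_axis_1)
  qed simp_all
  \<comment> \<open>The induction needs the agreement with \<open>D\<close> together with
    membership, as both are premises of \<open>step\<close> for the next derivative. It runs over
    all \<theta> in \<Theta> because difference quotients involve neighbouring parameters.\<close>
  have main: "?F js \<theta> \<in> L2 M \<and> (AE x in M. ?F js \<theta> x = D \<theta> (?E js) x)"
    if "length js \<le> m" "\<theta> \<in> \<Theta>" for js \<theta>
    using that
  proof (induction js arbitrary: \<theta>)
    case Nil
    have "D \<theta> [] \<in> L2 M"
      using ml[rule_format, of 0 \<theta>] Nil by (simp add: L2_bounded_multilinear_def)
    with Nil show ?case by (simp add: D0)
  next
    case (Cons i js)
    have t: "L2_tendsto M (\<lambda>t x. (?F js (\<theta> + t *\<^sub>R axis i 1) x - ?F js \<theta> x) / t) (D \<theta> (axis i 1 # ?E js)) (at 0)"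
      by (rule step) (use Cons in auto)
    note t' = L2_tendsto_L2_partial[OF t]
    show ?case
      using L2_tendsto_unique[OF t' t] t' by (simp add: L2_tendsto_def)
  qed
  show "length js \<le> m \<Longrightarrow> \<theta> \<in> \<Theta> \<Longrightarrow> ?F js \<theta> \<in> L2 M"
    using main by blast
  show "length js < m \<Longrightarrow> \<theta> \<in> \<Theta> \<Longrightarrow>
      L2_tendsto M (\<lambda>t x. (?F js (\<theta> + t *\<^sub>R axis i 1) x - ?F js \<theta> x) / t) (L2_partial M i (?F js) \<theta>) (at 0)"
    by (rule L2_tendsto_L2_partial, rule step) (use main in auto)
qed

section \<open>Multi-indices as sorted lists\<close>

lemma count_list_index_list: "count_list (index_list \<alpha>) k = \<alpha> k"
proof -
  have rep: "count_list (replicate n k) k = n" for n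
    by (induction n) auto
  \<comment> \<open>Stated for an arbitrary distinct list so that induction on the enumeration of
    the indices goes through.\<close>
  have *: "count_list (concat (map (\<lambda>i. replicate (\<alpha> i) i) xs)) k = (if k \<in> set xs then \<alpha> k else 0)"
    if "distinct xs" for xs
    using that by (induction xs) (auto simp: count_list_append count_list_0_iff rep)
  show ?thesis
    unfolding index_list_def by (subst *) auto
qed

lemma sorted_index_list: "sorted (index_list \<alpha>)"
proof -
  have "sorted (concat (map (\<lambda>i. replicate (\<alpha> i) i) xs))" if "sorted xs" for xs :: "'a list"
    using that by (induction xs) (auto simp: sorted_append)
  then show ?thesis
    unfolding index_list_def by simp
qed

text \<open>Both lists are sorted and have the same multiset of entries.\<close>

lemma index_list_count_list:
  assumes "sorted js"
  shows "index_list (count_list js) = js"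
proof -
  have "mset (index_list (count_list js)) = mset js"
    by (rule multiset_eqI) (simp add: count_mset count_list_index_list flip: count_list_eq_length_filter)
  then show ?thesis
    using sorted_index_list assms properties_for_sort by metis
qed

lemma length_index_list: "length (index_list \<alpha>) = mi_degree \<alpha>"
proof -
  have "length (index_list \<alpha>) = (\<Sum>k\<in>UNIV. count_list (index_list \<alpha>) k)"
    by (rule sum_count_set[symmetric]) auto
  then show ?thesis by (simp add: count_list_index_list mi_degree_def)
qed

text \<open>Lets sums over multi-indices be rewritten over sorted lists, where degrees 1 and 2 take
  the explicit shapes \<open>[i]\<close> and \<open>[i, j]\<close> with
  \<open>i \<le> j\<close>.\<close>

lemma bij_betw_index_list: "bij_betw index_list {\<alpha>. mi_degree \<alpha> \<in> N} {js. sorted js \<and> length js \<in> N}"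
proof (rule bij_betw_byWitness[where f' = count_list])
  have "mi_degree (count_list js) = length js" if "sorted js" for js :: "'a list"
    using length_index_list[of "count_list js"] index_list_count_list[OF that] by simp
  then show "count_list ` {js. sorted js \<and> length js \<in> N} \<subseteq> {\<alpha> :: 'a \<Rightarrow> nat. mi_degree \<alpha> \<in> N}"
    by auto
qed (auto simp: count_list_index_list sorted_index_list length_index_list index_list_count_list fun_eq_iff)

lemma mi_degree_count_list:
  fixes js :: "'d::{finite,linorder} list"
  assumes "sorted js"
  shows "mi_degree (count_list js) = length js"
  using length_index_list[of "count_list js"] by (simp add: index_list_count_list[OF assms])

section \<open>Regular families\<close>

text \<open>The Gram quadratic form of clause (iii), evaluated at the coefficients \<open>c\<close>,
  is the squared norm of the corresponding combination of derivatives.\<close>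

lemma regular_eta_combination_pos:
  fixes f :: "'d::{finite,linorder} rvec \<Rightarrow> 'a \<Rightarrow> real" and c :: "'d list \<Rightarrow> real"
  assumes reg: "regular M \<Theta> P f m \<theta>" and \<Theta>: "open \<Theta>" "\<theta> \<in> \<Theta>"
  defines "L \<equiv> {js. sorted js \<and> length js \<in> {1..m}}"
  assumes c: "\<exists>js\<in>L. c js \<noteq> 0"
  defines "u \<equiv> \<lambda>x. \<Sum>js\<in>L. c js * foldr (L2_partial M) js (sqrt_emb f) \<theta> x"
  shows "0 < L2_inner M u u"
proof -
  let ?E = "\<lambda>js. foldr (L2_partial M) js (sqrt_emb f) \<theta>"
  let ?A = "{\<alpha> :: 'd \<Rightarrow> nat. 1 \<le> mi_degree \<alpha> \<and> mi_degree \<alpha> \<le> m}"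
  have bij: "bij_betw index_list ?A L"
    using bij_betw_index_list[of "{1..m}"] by (simp add: L_def)
  have EL2: "?E js \<in> L2 M" if "js \<in> L" for js
    using reg \<Theta> that by (intro L2_partial_iterated(1)) (auto simp: regular_def L_def)
  have "\<exists>\<alpha>\<in>?A. c (index_list \<alpha>) \<noteq> 0"
    using c bij by (auto simp: bij_betw_def)
  with reg have "0 < (\<Sum>\<alpha>\<in>?A. \<Sum>\<beta>\<in>?A. c (index_list \<alpha>) * L2_inner M (?E (index_list \<alpha>)) (?E (index_list \<beta>)) * c (index_list \<beta>))"
    unfolding regular_def Let_def eta_def by auto
  also have "\<dots> = (\<Sum>js\<in>L. \<Sum>ks\<in>L. c js * L2_inner M (?E js) (?E ks) * c ks)"
    by (subst sum.reindex_bij_betw[OF bij, symmetric], rule sum.cong[OF refl],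
        subst sum.reindex_bij_betw[OF bij, symmetric]) simp
  also have "\<dots> = L2_inner M u u"
    unfolding u_def by (rule L2_inner_sum_sum[symmetric]) (use EL2 in auto)
  finally show ?thesis .
qed

text \<open>Linear independence of the first and second derivatives taken together; this is the form
  in which clause (iii) is used below.\<close>

lemma regular2_combination_pos:
  fixes f :: "'d::{finite,linorder} rvec \<Rightarrow> 'a \<Rightarrow> real"
  assumes reg: "regular M \<Theta> P f 2 \<theta>" and \<Theta>: "open \<Theta>" "\<theta> \<in> \<Theta>"
    and ab: "(\<exists>i. a i \<noteq> 0) \<or> (\<exists>(i, j)\<in>index_pairs. b (i, j) \<noteq> 0)"
  defines "u \<equiv> \<lambda>x. (\<Sum>i\<in>UNIV. a i * eta1 M f i \<theta> x) +
              (\<Sum>(i, j)\<in>index_pairs. b (i, j) * L2_partial M i (eta1 M f j) \<theta> x)"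
  shows "0 < L2_inner M u u"
proof -
  let ?E = "\<lambda>js. foldr (L2_partial M) js (sqrt_emb f) \<theta>"
  let ?L = "{js :: 'd list. sorted js \<and> length js \<in> {1..2}}"
  \<comment> \<open>List length separates the two orders, so that a single coefficient function on
    \<open>?L\<close> carries both \<open>a\<close> and \<open>b\<close>.\<close>
  define c where "c js = (case js of [i] \<Rightarrow> a i | [i, j] \<Rightarrow> b (i, j) | _ \<Rightarrow> 0)" for js
  have L: "?L = (\<lambda>i. [i]) ` UNIV \<union> (\<lambda>(i, j). [i, j]) ` index_pairs"
  proof (intro set_eqI iffI)
    fix js assume "js \<in> ?L"
    then have "(length js = Suc 0 \<or> length js = Suc (Suc 0)) \<and> sorted js" by auto
    then show "js \<in> (\<lambda>i. [i]) ` UNIV \<union> (\<lambda>(i, j). [i, j]) ` index_pairs"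
      unfolding length_Suc_conv index_pairs_def by force
  qed (auto simp: index_pairs_def)
  have u: "u = (\<lambda>x. \<Sum>js\<in>?L. c js * ?E js x)"
  proof
    fix x
    have "(\<Sum>js\<in>?L. c js * ?E js x)
        = (\<Sum>js\<in>(\<lambda>i. [i]) ` UNIV. c js * ?E js x) + (\<Sum>js\<in>(\<lambda>(i, j). [i, j]) ` index_pairs. c js * ?E js x)"
      unfolding L by (rule sum.union_disjoint) auto
    also have "(\<Sum>js\<in>(\<lambda>i. [i]) ` UNIV. c js * ?E js x) = (\<Sum>i\<in>UNIV. a i * eta1 M f i \<theta> x)"
      by (subst sum.reindex) (auto simp: inj_on_def c_def eta1_def)
    also have "(\<Sum>js\<in>(\<lambda>(i, j). [i, j]) ` index_pairs. c js * ?E js x)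
        = (\<Sum>(i, j)\<in>index_pairs. b (i, j) * L2_partial M i (eta1 M f j) \<theta> x)"
      by (subst sum.reindex) (auto simp: inj_on_def c_def eta1_def intro!: sum.cong)
    finally show "u x = (\<Sum>js\<in>?L. c js * ?E js x)"
      by (simp add: u_def)
  qed
  have "\<exists>js\<in>?L. c js \<noteq> 0"
    using ab
  proof
    assume "\<exists>i. a i \<noteq> 0"
    then obtain i where "a i \<noteq> 0" ..
    then show ?thesis by (intro bexI[of _ "[i]"]) (auto simp: c_def)
  next
    assume "\<exists>(i, j)\<in>index_pairs. b (i, j) \<noteq> 0"
    then obtain i j where "i \<le> j" "b (i, j) \<noteq> 0" by (auto simp: index_pairs_def)
    then show ?thesis by (intro bexI[of _ "[i, j]"]) (auto simp: c_def)
  qed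
  from regular_eta_combination_pos[OF reg \<Theta> this] show ?thesis
    by (simp add: u)
qed

lemma regular2_L2:
  fixes f :: "'d::{finite,linorder} rvec \<Rightarrow> 'a \<Rightarrow> real"
  assumes "regular M \<Theta> P f 2 \<theta>" "open \<Theta>" "\<theta> \<in> \<Theta>"
  shows "sqrt_emb f \<theta> \<in> L2 M" "eta1 M f i \<theta> \<in> L2 M" "L2_partial M i (eta1 M f j) \<theta> \<in> L2 M"
proof -
  have "L2_frechet_differentiable M 2 \<Theta> (sqrt_emb f)"
    using assms by (simp add: regular_def)
  note L = L2_partial_iterated(1)[OF this assms(2) _ assms(3)]
  show "sqrt_emb f \<theta> \<in> L2 M" "eta1 M f i \<theta> \<in> L2 M" "L2_partial M i (eta1 M f j) \<theta> \<in> L2 M"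
    using L[of "[]"] L[of "[i]"] L[of "[i, j]"] by (simp_all add: eta1_def)
qed

text \<open>A nonzero kernel vector would be the coefficient vector of a first-order combination
  with norm 0.\<close>

lemma regular2_gram_invertible:
  fixes f :: "'d::{finite,linorder} rvec \<Rightarrow> 'a \<Rightarrow> real"
  assumes "regular M \<Theta> P f 2 \<theta>" "open \<Theta>" "\<theta> \<in> \<Theta>"
  shows "invertible (gram M f \<theta>)"
proof -
  have "y = 0" if y: "gram M f \<theta> *v y = 0" for y
  proof (rule ccontr)
    assume "y \<noteq> 0"
    then have "\<exists>i. y $ i \<noteq> 0" by (simp add: vec_eq_iff)
    then have "0 < L2_inner M (\<lambda>x. \<Sum>i\<in>UNIV. y $ i * eta1 M f i \<theta> x) (\<lambda>x. \<Sum>i\<in>UNIV. y $ i * eta1 M f i \<theta> x)"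
      using regular2_combination_pos[OF assms, of "\<lambda>i. y $ i" "\<lambda>_. 0"] by simp
    also have "\<dots> = (\<Sum>i\<in>UNIV. \<Sum>j\<in>UNIV. y $ i * L2_inner M (eta1 M f i \<theta>) (eta1 M f j \<theta>) * y $ j)"
      by (intro L2_inner_sum_sum regular2_L2[OF assms])
    also have "\<dots> = y \<bullet> (gram M f \<theta> *v y)"
      by (simp add: inner_vec_def gram_def matrix_vector_mult_def sum_distrib_left mult.assoc)
    finally show False using y by simp
  qed
  then show ?thesis
    by (simp add: invertible_left_inverse matrix_left_invertible_ker)
qed

section \<open>Densities, interchange of derivative and integral, and unbiasedness\<close>

lemma density_family_integral:
  assumes "density_family M \<Theta> P f" "\<theta> \<in> \<Theta>" and X: "X \<in> borel_measurable M"
  shows "integral\<^sup>L (P \<theta>) X = (\<integral>x. X x * f \<theta> x \<partial>M)"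
    and "integrable (P \<theta>) X \<longleftrightarrow> integrable M (\<lambda>x. X x * f \<theta> x)"
proof -
  have f: "f \<theta> \<in> borel_measurable M" "AE x in M. 0 \<le> f \<theta> x" "P \<theta> = density M (\<lambda>x. ennreal (f \<theta> x))"
    using assms by (auto simp: density_family_def intro!: AE_I2 less_imp_le)
  show "integral\<^sup>L (P \<theta>) X = (\<integral>x. X x * f \<theta> x \<partial>M)"
    using integral_real_density[OF f(1,2) X] by (simp add: f(3) mult.commute)
  show "integrable (P \<theta>) X \<longleftrightarrow> integrable M (\<lambda>x. X x * f \<theta> x)"
    using integrable_real_density[OF f(1,2) X] by (simp add: f(3) mult.commute)
qed

lemma regular_partials_exist:
  assumes "regular M \<Theta> P f m \<theta>" "sorted js" "length js \<le> m" "x \<in> space M"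
  shows "partials_exist \<Theta> js (\<lambda>\<theta>. f \<theta> x)"
proof -
  have "\<forall>\<alpha>. mi_degree \<alpha> \<le> m \<longrightarrow> (\<forall>x\<in>space M. partials_exist \<Theta> (index_list \<alpha>) (\<lambda>\<theta>. f \<theta> x))"
    using assms(1) by (simp add: regular_def)
  from this[rule_format, of "count_list js" x] assms(2-) show ?thesis
    by (simp add: index_list_count_list mi_degree_count_list)
qed

lemma regular_interchange:
  assumes "regular M \<Theta> P f m \<theta>" "sorted js" "length js \<le> m" "\<theta>' \<in> \<Theta>"
    and "X \<in> borel_measurable M" "\<And>\<theta>. \<theta> \<in> \<Theta> \<Longrightarrow> integrable (P \<theta>) (\<lambda>x. (X x)\<^sup>2)"
  shows "integrable M (\<lambda>x. X x * foldr partial js (\<lambda>\<theta>. f \<theta> x) \<theta>')"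
    and "foldr partial js (\<lambda>\<theta>. \<integral>x. X x * f \<theta> x \<partial>M) \<theta>' = (\<integral>x. X x * foldr partial js (\<lambda>\<theta>. f \<theta> x) \<theta>' \<partial>M)"
proof -
  let ?\<alpha> = "count_list js"
  have degree: "mi_degree ?\<alpha> \<le> m"
    using assms(2,3) by (simp add: mi_degree_count_list)
  have all: "\<forall>X\<in>borel_measurable M. (\<forall>\<theta>\<in>\<Theta>. integrable (P \<theta>) (\<lambda>x. (X x)\<^sup>2)) \<longrightarrow>
        (\<forall>\<alpha>. mi_degree \<alpha> \<le> m \<longrightarrow>
           partials_exist \<Theta> (index_list \<alpha>) (\<lambda>\<theta>. \<integral>x. X x * f \<theta> x \<partial>M) \<and>
           (\<forall>\<theta>\<in>\<Theta>.
              integrable M (\<lambda>x. X x * foldr partial (index_list \<alpha>) (\<lambda>\<theta>. f \<theta> x) \<theta>) \<and>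
              foldr partial (index_list \<alpha>) (\<lambda>\<theta>. \<integral>x. X x * f \<theta> x \<partial>M) \<theta> =
                (\<integral>x. X x * foldr partial (index_list \<alpha>) (\<lambda>\<theta>. f \<theta> x) \<theta> \<partial>M)))"
    using assms(1) by (simp add: regular_def)
  have "\<forall>\<theta>\<in>\<Theta>. integrable (P \<theta>) (\<lambda>x. (X x)\<^sup>2)"
    using assms(6) by blast
  from bspec[OF all assms(5), THEN mp, OF this, THEN spec, THEN mp, OF degree,
      THEN conjunct2, THEN bspec, OF assms(4), unfolded index_list_count_list[OF assms(2)]]
  show "integrable M (\<lambda>x. X x * foldr partial js (\<lambda>\<theta>. f \<theta> x) \<theta>')"
    and "foldr partial js (\<lambda>\<theta>. \<integral>x. X x * f \<theta> x \<partial>M) \<theta>' = (\<integral>x. X x * foldr partial js (\<lambda>\<theta>. f \<theta> x) \<theta>' \<partial>M)"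
    by simp_all
qed

text \<open>The difference quotients of the square root of the density converge both in mean square
  and pointwise, so the two limits agree almost everywhere; the pointwise one comes from the chain
  rule, where positivity of the density enters.\<close>

lemma eta1_eq_pointwise:
  fixes f :: "'d::{finite,linorder} rvec \<Rightarrow> 'a \<Rightarrow> real"
  assumes dens: "density_family M \<Theta> P f" and reg: "regular M \<Theta> P f 2 \<theta>"
    and \<Theta>: "open \<Theta>" "\<theta> \<in> \<Theta>"
  shows "AE x in M. eta1 M f i \<theta> x = partial i (\<lambda>\<theta>. f \<theta> x) \<theta> / (2 * sqrt_emb f \<theta> x)"
proof -
  have "L2_frechet_differentiable M 2 \<Theta> (sqrt_emb f)"
    using reg by (simp add: regular_def)
  from L2_partial_iterated(2)[OF this \<Theta>(1) _ \<Theta>(2), of "[]" i]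
  have L2: "L2_tendsto M (\<lambda>t x. (sqrt_emb f (\<theta> + t *\<^sub>R axis i 1) x - sqrt_emb f \<theta> x) / t) (eta1 M f i \<theta>) (at 0)"
    by (simp add: eta1_def)
  show ?thesis
  proof (rule L2_tendsto_pointwise[OF L2])
    fix x assume x: "x \<in> space M"
    have pos: "0 < f \<theta> x"
      using dens \<Theta> x by (auto simp: density_family_def)
    let ?g = "\<lambda>t. f (\<theta> + t *\<^sub>R axis i 1) x"
    have "?g differentiable (at 0)"
      using regular_partials_exist[OF reg, of "[i]" x] x \<Theta> by simp
    then have "(?g has_real_derivative partial i (\<lambda>\<theta>. f \<theta> x) \<theta>) (at 0)"
      unfolding partial_def
      by (simp add: DERIV_deriv_iff_real_differentiable)
    then have "((\<lambda>t. sqrt (?g t)) has_real_derivative partial i (\<lambda>\<theta>. f \<theta> x) \<theta> / (2 * sqrt_emb f \<theta> x)) (at 0)"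
      using pos by (auto intro!: derivative_eq_intros simp: sqrt_emb_def divide_simps)
    then show "((\<lambda>t. (sqrt_emb f (\<theta> + t *\<^sub>R axis i 1) x - sqrt_emb f \<theta> x) / t)
        \<longlongrightarrow> partial i (\<lambda>\<theta>. f \<theta> x) \<theta> / (2 * sqrt_emb f \<theta> x)) (at 0)"
      by (simp add: DERIV_def sqrt_emb_def)
  qed
qed

text \<open>Taking components of the vector-valued mean requires integrability of \<open>T\<close>,
  which follows from square integrability of the components under a probability measure.\<close>

lemma unbiased_estimator_component:
  fixes T :: "'a \<Rightarrow> real^'d::finite"
  assumes dens: "density_family M \<Theta> P f" and T: "unbiased_estimator M \<Theta> P T" and \<theta>: "\<theta> \<in> \<Theta>"
  shows "integrable (P \<theta>) (\<lambda>x. T x $ p)" "(\<integral>x. T x $ p \<partial>P \<theta>) = \<theta> $ p"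
proof -
  interpret prob_space "P \<theta>"
    using dens \<theta> unfolding density_family_def by blast
  have "sets (P \<theta>) = sets M"
    using dens \<theta> by (auto simp: density_family_def)
  then have [measurable]: "T \<in> borel_measurable (P \<theta>)"
    using T by (simp add: unbiased_estimator_def cong: measurable_cong_sets)
  have sq: "integrable (P \<theta>) (\<lambda>x. (T x $ p)\<^sup>2)" for p
    using T \<theta> by (simp add: unbiased_estimator_def)
  show int: "integrable (P \<theta>) (\<lambda>x. T x $ p)" for p
    by (rule square_integrable_imp_integrable[OF measurable_compose[OF _ borel_measurable_nth] sq]) measurable
  have "integrable (P \<theta>) (\<lambda>x. \<Sum>p\<in>UNIV. (T x $ p) *\<^sub>R axis p (1::real))"
    by (intro Bochner_Integration.integrable_sum integrable_scaleR_left int)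
  moreover have "(\<Sum>p\<in>UNIV. (y $ p) *\<^sub>R axis p (1::real)) = y" for y :: "real^'d"
    by (simp add: vec_eq_iff axis_def if_distrib cong: if_cong)
  ultimately have "integrable (P \<theta>) T" by simp
  then have "(\<integral>x. T x $ p \<partial>P \<theta>) = (\<integral>x. T x \<partial>P \<theta>) $ p"
    by (rule integral_bounded_linear[OF bounded_linear_vec_nth])
  then show "(\<integral>x. T x $ p \<partial>P \<theta>) = \<theta> $ p"
    using T \<theta> by (simp add: unbiased_estimator_def)
qed

section \<open>Lifted errors and their pairing with the first derivatives\<close>

context
  fixes M :: "'a measure" and \<Theta> :: "('d::{finite,linorder} rvec) set"
    and P f and T :: "'a \<Rightarrow> 'd rvec" and \<theta> :: "'d rvec"
  assumes \<Theta>: "open \<Theta>" "\<theta> \<in> \<Theta>"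
    and dens: "density_family M \<Theta> P f"
    and reg: "regular M \<Theta> P f 2 \<theta>"
    and T: "unbiased_estimator M \<Theta> P T"
begin

lemma estimator_measurable: "(\<lambda>x. T x $ p) \<in> borel_measurable M"
  using T by (auto simp: unbiased_estimator_def intro: measurable_compose[OF _ borel_measurable_nth])

text \<open>The centre \<open>c\<close> is independent of the parameter: the interchange condition
  is applied to the error centred at \<theta>, which must be square integrable under every member of
  the family.\<close>

lemma error_square_integrable:
  assumes "\<theta>' \<in> \<Theta>"
  shows "integrable (P \<theta>') (\<lambda>x. (T x $ p - c)\<^sup>2)"
proof -
  interpret prob_space "P \<theta>'"
    using dens assms unfolding density_family_def by blast
  have "integrable (P \<theta>') (\<lambda>x. (T x $ p)\<^sup>2)"
    using T assms by (simp add: unbiased_estimator_def)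
  then show ?thesis
    using unbiased_estimator_component(1)[OF dens T assms]
    by (simp add: power2_diff)
qed

lemma lifted_error_mult:
  assumes "x \<in> space M"
  shows "lifted_error f T \<theta> p x * lifted_error f T \<theta> q x
           = (T x $ p - \<theta> $ p) * (T x $ q - \<theta> $ q) * f \<theta> x"
proof -
  have "0 < f \<theta> x"
    using dens \<Theta> assms by (auto simp: density_family_def)
  then have "sqrt (f \<theta> x) * sqrt (f \<theta> x) = f \<theta> x" by simp
  then show ?thesis
    by (simp add: lifted_error_def sqrt_emb_def mult_ac)
qed

lemma lifted_error_L2: "lifted_error f T \<theta> p \<in> L2 M"
proof -
  have [measurable]: "(\<lambda>x. T x $ p) \<in> borel_measurable M" "sqrt_emb f \<theta> \<in> borel_measurable M"
    using estimator_measurable L2_measurable[OF regular2_L2(1)[OF reg \<Theta>]] by auto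
  have "integrable M (\<lambda>x. (T x $ p - \<theta> $ p)\<^sup>2 * f \<theta> x)"
    using error_square_integrable[OF \<Theta>(2)] density_family_integral(2)[OF dens \<Theta>(2), of "\<lambda>x. (T x $ p - \<theta> $ p)\<^sup>2"]
    by simp
  then have "integrable M (\<lambda>x. (lifted_error f T \<theta> p x)\<^sup>2)"
    by (subst Bochner_Integration.integrable_cong[OF refl])
      (auto simp: power2_eq_square lifted_error_mult)
  then show ?thesis
    unfolding L2_def lifted_error_def by simp
qed

lemma lifted_error_inner:
  "L2_inner M (lifted_error f T \<theta> p) (lifted_error f T \<theta> q) = cov_mat P T \<theta> $ p $ q"
proof -
  have [measurable]: "(\<lambda>x. T x $ p) \<in> borel_measurable M" for p
    by (rule estimator_measurable)
  show ?thesis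
    unfolding L2_inner_def cov_mat_def
    by (simp add: density_family_integral(1)[OF dens \<Theta>(2)] lifted_error_mult
        cong: Bochner_Integration.integral_cong)
qed

text \<open>The factor \<open>sqrt_emb f \<theta>\<close> of the lifted error cancels the one in the
  denominator of \<open>eta1\<close>, leaving half the integral of the error against the derivative
  of the density. By interchange that integral is the derivative of the mean error.\<close>

lemma lifted_error_eta1:
  "L2_inner M (lifted_error f T \<theta> p) (eta1 M f i \<theta>) = (if p = i then 1 / 2 else 0)"
proof -
  let ?X = "\<lambda>x. T x $ p - \<theta> $ p"
  let ?d = "if p = i then 1 else 0 :: real"
  have X [measurable]: "?X \<in> borel_measurable M"
    using estimator_measurable by simp
  note interchange = regular_interchange[OF reg _ _ \<Theta>(2) X error_square_integrable, of "[i]"]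
  have int: "integrable M (\<lambda>x. ?X x * partial i (\<lambda>\<theta>. f \<theta> x) \<theta>)"
    and eq: "partial i (\<lambda>\<theta>. \<integral>x. ?X x * f \<theta> x \<partial>M) \<theta> = (\<integral>x. ?X x * partial i (\<lambda>\<theta>. f \<theta> x) \<theta> \<partial>M)"
    using interchange by simp_all
  \<comment> \<open>The error stays centred at \<theta> while the measure moves, so its mean is
    affine in the moving parameter.\<close>
  have mean: "(\<integral>x. ?X x * f \<theta>' x \<partial>M) = \<theta>' $ p - \<theta> $ p" if "\<theta>' \<in> \<Theta>" for \<theta>'
  proof -
    interpret prob_space "P \<theta>'"
      using dens that unfolding density_family_def by blast
    show ?thesis
      using unbiased_estimator_component[OF dens T that]
      by (simp add: density_family_integral(1)[OF dens that X, symmetric] prob_space)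
  qed
  \<comment> \<open>A full neighbourhood of 0 is used, including 0 itself, because
    \<open>deriv_cong_ev\<close> compares functions near and at the point.\<close>
  have "((\<lambda>t::real. \<theta> + t *\<^sub>R axis i 1) \<longlongrightarrow> \<theta>) (nhds 0)"
    by (auto intro!: tendsto_eq_intros filterlim_ident)
  then have "\<forall>\<^sub>F t::real in nhds 0. \<theta> + t *\<^sub>R axis i 1 \<in> \<Theta>"
    using topological_tendstoD \<Theta> by blast
  then have "\<forall>\<^sub>F t in nhds 0. (\<integral>x. ?X x * f (\<theta> + t *\<^sub>R axis i 1) x \<partial>M) = t * ?d"
    by eventually_elim (auto simp: mean axis_def)
  then have "partial i (\<lambda>\<theta>. \<integral>x. ?X x * f \<theta> x \<partial>M) \<theta> = deriv (\<lambda>t. t * ?d) 0"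
    unfolding partial_def by (rule deriv_cong_ev) simp
  also have "\<dots> = ?d"
    by (rule DERIV_imp_deriv) (auto intro!: derivative_eq_intros)
  finally have d: "(\<integral>x. ?X x * partial i (\<lambda>\<theta>. f \<theta> x) \<theta> \<partial>M) = ?d"
    using eq by simp
  have ae: "AE x in M. lifted_error f T \<theta> p x * eta1 M f i \<theta> x = ?X x * partial i (\<lambda>\<theta>. f \<theta> x) \<theta> / 2"
    using eta1_eq_pointwise[OF dens reg \<Theta>, of i] AE_space
  proof eventually_elim
    case (elim x)
    then have "0 < sqrt_emb f \<theta> x"
      using dens \<Theta> by (auto simp: density_family_def sqrt_emb_def)
    then show ?case
      by (simp add: elim(1) lifted_error_def)
  qed
  have "L2_inner M (lifted_error f T \<theta> p) (eta1 M f i \<theta>) = (\<integral>x. ?X x * partial i (\<lambda>\<theta>. f \<theta> x) \<theta> / 2 \<partial>M)"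
    unfolding L2_inner_def
    using L2_mult_integrable[OF lifted_error_L2 regular2_L2(2)[OF reg \<Theta>]] int
    by (intro integral_cong_AE ae) (auto dest: borel_measurable_integrable)
  also have "\<dots> = ?d / 2"
    by (simp only: integral_divide_zero d)
  finally show ?thesis
    by (cases "p = i") simp_all
qed

section \<open>The second fundamental form\<close>

lemma second_form_eq:
  obtains c where "second_form M f \<theta> a =
      (\<lambda>x. L2_partial M (fst a) (eta1 M f (snd a)) \<theta> x - (\<Sum>k\<in>UNIV. c k * eta1 M f k \<theta> x))"
    and "\<And>k. L2_inner M (second_form M f \<theta> a) (eta1 M f k \<theta>) = 0"
proof -
  let ?u = "L2_partial M (fst a) (eta1 M f (snd a)) \<theta>"
  \<comment> \<open>Invertibility of the Gram matrix guarantees that a projection to the tangent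
    space exists and hence that \<open>L2_proj\<close> returns one.\<close>
  obtain c where c: "L2_proj M (tangent1 M f \<theta>) ?u = (\<lambda>x. \<Sum>k\<in>UNIV. c k * eta1 M f k \<theta> x)"
    "\<And>k. L2_inner M (\<lambda>x. ?u x - (\<Sum>k\<in>UNIV. c k * eta1 M f k \<theta> x)) (eta1 M f k \<theta>) = 0"
    by (rule L2_proj_span[where u = ?u and e = "\<lambda>i. eta1 M f i \<theta>", OF regular2_L2(3,2)[OF reg \<Theta>]
          regular2_gram_invertible[OF reg \<Theta>, unfolded gram_def], folded tangent1_def],
        rule that)
  have eq: "second_form M f \<theta> a = (\<lambda>x. ?u x - (\<Sum>k\<in>UNIV. c k * eta1 M f k \<theta> x))"
    by (simp add: second_form_def case_prod_unfold c(1))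
  from eq c(2)[folded eq] show thesis by (rule that)
qed

lemma second_form_L2: "second_form M f \<theta> a \<in> L2 M"
  by (rule second_form_eq[of a]) (simp add: L2_diff L2_sum regular2_L2[OF reg \<Theta>])

text \<open>Projecting alters only first-order coefficients, so the second-order coefficients \<xi>
  survive in \<open>n\<close> and linear independence up to order 2 applies.\<close>

lemma second_form_combination_pos:
  assumes "\<exists>a\<in>index_pairs. \<xi> a \<noteq> 0"
  defines "n \<equiv> \<lambda>x. \<Sum>a\<in>index_pairs. \<xi> a * second_form M f \<theta> a x"
  shows "0 < L2_inner M n n"
proof -
  have "\<forall>a. \<exists>c. second_form M f \<theta> a =
      (\<lambda>x. L2_partial M (fst a) (eta1 M f (snd a)) \<theta> x - (\<Sum>k\<in>UNIV. c k * eta1 M f k \<theta> x))"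
    by (intro allI, rule second_form_eq) (rule exI)
  from choice[OF this] obtain c where c: "\<And>a. second_form M f \<theta> a =
      (\<lambda>x. L2_partial M (fst a) (eta1 M f (snd a)) \<theta> x - (\<Sum>k\<in>UNIV. c a k * eta1 M f k \<theta> x))"
    by blast
  \<comment> \<open>Total coefficient of the \<open>k\<close>-th first derivative contributed by all
    the subtracted projections.\<close>
  define b where "b k = - (\<Sum>a\<in>index_pairs. \<xi> a * c a k)" for k
  have "n = (\<lambda>x. (\<Sum>k\<in>UNIV. b k * eta1 M f k \<theta> x) + (\<Sum>(i, j)\<in>index_pairs. \<xi> (i, j) * L2_partial M i (eta1 M f j) \<theta> x))"
  proof
    fix x
    have "(\<Sum>a\<in>index_pairs. \<xi> a * (\<Sum>k\<in>UNIV. c a k * eta1 M f k \<theta> x)) = - (\<Sum>k\<in>UNIV. b k * eta1 M f k \<theta> x)"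
      unfolding b_def
      by (simp add: sum_negf sum_distrib_left sum_distrib_right mult.assoc) (rule sum.swap)
    then show "n x = (\<Sum>k\<in>UNIV. b k * eta1 M f k \<theta> x) + (\<Sum>(i, j)\<in>index_pairs. \<xi> (i, j) * L2_partial M i (eta1 M f j) \<theta> x)"
      by (simp add: n_def c right_diff_distrib sum_subtractf case_prod_unfold)
  qed
  moreover have "\<exists>(i, j)\<in>index_pairs. \<xi> (i, j) \<noteq> 0"
    using assms by auto
  ultimately show ?thesis
    using regular2_combination_pos[OF reg \<Theta>, of b \<xi>] by simp
qed

text \<open>Instance of the projected Cauchy-Schwarz inequality with the first derivatives spanning
  the subspace. It holds for arbitrary coefficients \<xi>, as every combination of second form
  components is normal.\<close>

lemma cov_mat_minus_fisher_inv_bound: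
  fixes v :: "'d rvec" and \<xi> :: "'d \<times> 'd \<Rightarrow> real"
  defines "z \<equiv> \<lambda>x. \<Sum>p\<in>UNIV. v $ p * lifted_error f T \<theta> p x"
    and "n \<equiv> \<lambda>x. \<Sum>a\<in>index_pairs. \<xi> a * second_form M f \<theta> a x"
  shows "(L2_inner M z n)\<^sup>2
           \<le> (v \<bullet> ((cov_mat P T \<theta> - matrix_inv (fisher_info M f \<theta>)) *v v)) * L2_inner M n n"
proof -
  note inv = regular2_gram_invertible[OF reg \<Theta>]
  define w where "w = matrix_inv (gram M f \<theta>) *v v"
  have w: "(\<chi> i j. L2_inner M (eta1 M f i \<theta>) (eta1 M f j \<theta>)) *v w = v"
    using matrix_inv_inverse(1)[OF inv]
    by (simp add: w_def matrix_vector_mul_assoc flip: gram_def)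
  have ze: "L2_inner M z (eta1 M f i \<theta>) = v $ i / 2" for i
    unfolding z_def
    by (simp add: L2_inner_sum_left lifted_error_L2 regular2_L2[OF reg \<Theta>] lifted_error_eta1
        if_distrib[of "(*) _"] cong: if_cong)
  have ne: "L2_inner M n (eta1 M f i \<theta>) = 0" for i
  proof -
    have "L2_inner M (second_form M f \<theta> a) (eta1 M f i \<theta>) = 0" for a
      by (rule second_form_eq[of a])
    then show ?thesis
      unfolding n_def by (simp add: L2_inner_sum_left second_form_L2 regular2_L2[OF reg \<Theta>])
  qed
  have zz: "L2_inner M z z = v \<bullet> (cov_mat P T \<theta> *v v)"
    unfolding z_def
    by (simp add: L2_inner_sum_sum lifted_error_L2 lifted_error_inner inner_vec_def
        matrix_vector_mult_def sum_distrib_left mult.assoc)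
  \<comment> \<open>The Fisher information is 4 times the Gram matrix, which accounts for the
    quarter in the projected inequality.\<close>
  have "matrix_inv (fisher_info M f \<theta>) = (1 / 4) *\<^sub>R matrix_inv (gram M f \<theta>)"
    unfolding fisher_info_def by (rule matrix_inv_scaleR[OF inv]) simp
  then have fisher: "v \<bullet> (matrix_inv (fisher_info M f \<theta>) *v v) = (v \<bullet> w) / 4"
    by (simp add: w_def scaleR_matrix_vector_assoc[symmetric])
  have "z \<in> L2 M" "n \<in> L2 M"
    unfolding z_def n_def by (auto intro!: L2_sum lifted_error_L2 second_form_L2)
  then show ?thesis
    using L2_projected_cauchy_schwarz[of z M n "\<lambda>i. eta1 M f i \<theta>", OF _ _ regular2_L2(2)[OF reg \<Theta>] ze ne w]
    by (simp add: zz fisher matrix_vector_mult_diff_rdistrib inner_diff_right)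
qed

text \<open>Bilinearity turns the coordinate expressions into the pairing of lifted error and
  curvature vector and the squared norm of the latter.\<close>

lemma P_form_eq:
  fixes v :: "'d rvec"
  defines "z \<equiv> \<lambda>x. \<Sum>p\<in>UNIV. v $ p * lifted_error f T \<theta> p x"
    and "n \<equiv> \<lambda>x. \<Sum>a\<in>index_pairs. xi_vec M f \<theta> v a * second_form M f \<theta> a x"
  shows "P_form M f T \<theta> \<Delta> v = (L2_inner M z n)\<^sup>2 - (v \<bullet> (\<Delta> *v v)) * L2_inner M n n"
proof -
  have "L2_inner M z n = (\<Sum>p\<in>UNIV. \<Sum>a\<in>index_pairs. v $ p * cross_C M f T \<theta> p a * xi_vec M f \<theta> v a)"
    unfolding z_def n_def cross_C_def
    by (rule L2_inner_sum_sum) (auto intro: lifted_error_L2 second_form_L2)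
  also have "\<dots> = (\<Sum>a\<in>index_pairs. delta_vec M f T \<theta> v a * xi_vec M f \<theta> v a)"
    by (subst sum.swap) (simp add: delta_vec_def sum_distrib_left sum_distrib_right mult_ac)
  finally have zn: "L2_inner M z n = \<dots>" .
  have "L2_inner M n n = (\<Sum>a\<in>index_pairs. \<Sum>b\<in>index_pairs. xi_vec M f \<theta> v a * gram_N M f \<theta> a b * xi_vec M f \<theta> v b)"
    unfolding n_def gram_N_def by (rule L2_inner_sum_sum) (auto intro: second_form_L2)
  then show ?thesis
    unfolding P_form_def zn by simp
qed

lemma quadratic_form_le_of_P_form_nonneg:
  assumes "0 \<le> P_form M f T \<theta> \<Delta> v"
  shows "v \<bullet> (\<Delta> *v v) \<le> v \<bullet> ((cov_mat P T \<theta> - matrix_inv (fisher_info M f \<theta>)) *v v)"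
\<comment> \<open>At \<open>v = 0\<close> the curvature vector vanishes and could not be cancelled,
  but both sides are 0.\<close>
proof (cases "v = 0")
  case False
  define n where "n = (\<lambda>x. \<Sum>a\<in>index_pairs. xi_vec M f \<theta> v a * second_form M f \<theta> a x)"
  define w where "w = matrix_inv (gram M f \<theta>) *v v"
  have "gram M f \<theta> *v w = v"
    using matrix_inv_inverse(1)[OF regular2_gram_invertible[OF reg \<Theta>]]
    by (simp add: w_def matrix_vector_mul_assoc)
  \<comment> \<open>\<open>w\<close> cannot vanish since the Gram matrix maps it to the nonzero
    \<open>v\<close>; a nonzero coordinate shows up squared in a diagonal entry of
    \<open>xi_vec\<close>.\<close>
  with False obtain i where "w $ i \<noteq> 0"
    by (metis matrix_vector_mult_0_right vec_eq_iff zero_index)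
  then have "xi_vec M f \<theta> v (i, i) \<noteq> 0"
    by (simp add: xi_vec_def w_def)
  then have "\<exists>a\<in>index_pairs. xi_vec M f \<theta> v a \<noteq> 0"
    by (intro bexI[of _ "(i, i)"]) (auto simp: index_pairs_def)
  then have pos: "0 < L2_inner M n n"
    unfolding n_def by (rule second_form_combination_pos)
  have "(v \<bullet> (\<Delta> *v v)) * L2_inner M n n
      \<le> (v \<bullet> ((cov_mat P T \<theta> - matrix_inv (fisher_info M f \<theta>)) *v v)) * L2_inner M n n"
    using assms cov_mat_minus_fisher_inv_bound[of v "xi_vec M f \<theta> v"]
    unfolding P_form_eq n_def by linarith
  with pos show ?thesis by simp
qed simp

section \<open>Symmetry of the matrices, as demanded by the Loewner order\<close>

lemma transpose_cov_mat: "transpose (cov_mat P T \<theta>) = cov_mat P T \<theta>"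
  by (simp add: cov_mat_def transpose_def mult.commute)

lemma transpose_fisher_inv: "transpose (matrix_inv (fisher_info M f \<theta>)) = matrix_inv (fisher_info M f \<theta>)"
proof -
  have "transpose (gram M f \<theta>) = gram M f \<theta>"
    by (simp add: gram_def transpose_def L2_inner_commute)
  then have "transpose (matrix_inv (gram M f \<theta>)) = matrix_inv (gram M f \<theta>)"
    using transpose_matrix_inv[OF regular2_gram_invertible[OF reg \<Theta>]] by simp
  then show ?thesis
    unfolding fisher_info_def
    by (simp add: matrix_inv_scaleR[OF regular2_gram_invertible[OF reg \<Theta>]] transpose_scalar)
qed

end

theorem theorem8:
  fixes M :: "'a measure"
    and \<Theta> :: "('d::{finite,linorder} rvec) set"
    and P :: "'d rvec \<Rightarrow> 'a measure"
    and f :: "'d rvec \<Rightarrow> 'a \<Rightarrow> real"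
    and T :: "'a \<Rightarrow> 'd rvec"
    and \<theta> :: "'d rvec"
    and \<Delta> :: "'d rmat"
    and S :: "('d \<Rightarrow> nat) \<Rightarrow> ('d \<Rightarrow> nat) \<Rightarrow> real"
  assumes "sigma_finite_measure M"
    and "open \<Theta>" and "\<theta> \<in> \<Theta>"
    and "density_family M \<Theta> P f"
    and "regular M \<Theta> P f 2 \<theta>"
    and "unbiased_estimator M \<Theta> P T"
    and "transpose \<Delta> = \<Delta>" and "loewner_ge \<Delta> 0"
    and "symmetric_on (monomials 3) S" and "psd_on (monomials 3) S"
    and "\<forall>v. P_form M f T \<theta> \<Delta> v =
           (\<Sum>\<alpha>\<in>monomials 3. \<Sum>\<beta>\<in>monomials 3. monomial \<alpha> v * S \<alpha> \<beta> * monomial \<beta> v)"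
  shows "(\<forall>v. v \<bullet> (\<Delta> *v v) \<le> v \<bullet> ((cov_mat P T \<theta> - matrix_inv (fisher_info M f \<theta>)) *v v)) \<and>
         loewner_ge (cov_mat P T \<theta>) (matrix_inv (fisher_info M f \<theta>) + \<Delta>)"
proof -
  note setting = assms(2-6)
  \<comment> \<open>At each fixed \<open>v\<close> the right side of the identity is the quadratic
    form of \<open>S\<close> at the vector
    \<open>\<lambda>\<alpha>. monomial \<alpha> v\<close>.\<close>
  have "0 \<le> P_form M f T \<theta> \<Delta> v" for v
    using assms(10,11) unfolding psd_on_def by simp
  then have le: "v \<bullet> (\<Delta> *v v) \<le> v \<bullet> ((cov_mat P T \<theta> - matrix_inv (fisher_info M f \<theta>)) *v v)" for v
    by (rule quadratic_form_le_of_P_form_nonneg[OF setting])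
  moreover have "transpose (cov_mat P T \<theta> - (matrix_inv (fisher_info M f \<theta>) + \<Delta>))
      = cov_mat P T \<theta> - (matrix_inv (fisher_info M f \<theta>) + \<Delta>)"
    using transpose_cov_mat[OF setting] transpose_fisher_inv[OF setting] assms(7)
    by (simp add: transpose_def vec_eq_iff)
  moreover have "0 \<le> v \<bullet> ((cov_mat P T \<theta> - (matrix_inv (fisher_info M f \<theta>) + \<Delta>)) *v v)" for v
    using le[of v]
    by (simp add: matrix_vector_mult_diff_rdistrib matrix_vector_mult_add_rdistrib inner_diff_right inner_add_right)
  ultimately show ?thesis
    by (simp add: loewner_ge_def psd_def)
qed

end
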